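(* Let $P$ be an arbitrary finite poset and $K$ a field. Then the Rees algebra $\mathcal{R}(H_P)$ is normal and Koszul.
   Context: A poset ideal of a finite poset $P$ is a subset $I\subset P$ such that $x\in I$, $y\in P$, $y\le x$ imply $y\in I$ ($\emptyset$ and $P$ are poset ideals). $\mathcal{J}(P)$ is the set of all poset ideals of $P$, ordered by inclusion. Let $S=K[\{x_p,y_p\}_{p\in P}]$, a polynomial ring in $2|P|$ variables. For $I\in\mathcal{J}(P)$ set $u_I=\bigl(\prod_{p\in I}x_p\bigr)\bigl(\prod_{p\in P\setminus I}y_p\bigr)$, and let $H_P\subset S$ be the ideal generated by all $u_I$, $I\in\mathcal{J}(P)$. The Rees algebra of $H_P$ is $\mathcal{R}(H_P)=K[\{x_p,y_p\}_{p\in P},\{u_It\}_{I\in\mathcal{J}(P)}]\subset S[t]$. It is regarded as a standard graded $K$-algebra in which all the generators $x_p$, $y_p$, $u_It$ have degree $1$; Koszul means that the residue field $K$ has a linear graded free resolution over this standard graded algebra. *)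

theory Defs
  imports
    "HOL-Library.Poly_Mapping"
    "HOL-Computational_Algebra.Polynomial"
    "HOL-Computational_Algebra.Fraction_Field"
begin

section \<open>Normal domains\<close>

definition integral_over :: "'a::comm_ring_1 set \<Rightarrow> 'a \<Rightarrow> bool" where
  "integral_over R z \<longleftrightarrow>
     (\<exists>f. lead_coeff f = 1 \<and> (\<forall>i. coeff f i \<in> R) \<and> poly f z = 0)"

text \<open>
  A domain is given as a subring \<open>R\<close> of an ambient integral domain, so that its field of
  fractions is the subfield of the ambient fraction field formed by the quotients of elements
  of \<open>R\<close>.
\<close>

definition fractions :: "'a::idom set \<Rightarrow> 'a fract set" where
  "fractions R = {Fract a b | a b. a \<in> R \<and> b \<in> R \<and> b \<noteq> 0}"

definition normal_domain :: "'a::idom set \<Rightarrow> bool" where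
  "normal_domain R \<longleftrightarrow>
     1 \<in> R \<and> (\<forall>x\<in>R. \<forall>y\<in>R. x - y \<in> R \<and> x * y \<in> R) \<and>
     (\<forall>z\<in>fractions R. integral_over ((\<lambda>a. Fract a 1) ` R) z \<longrightarrow> z \<in> (\<lambda>a. Fract a 1) ` R)"


section \<open>Standard graded algebras and Koszulness\<close>

definition products :: "'a::comm_monoid_mult set \<Rightarrow> nat \<Rightarrow> 'a set" where
  "products G n = {prod_list gs | gs. length gs = n \<and> set gs \<subseteq> G}"

text \<open>
  \<open>R\<close> is a subalgebra, with homogeneous components \<open>A n\<close>, of the \<open>'k\<close>-algebra \<open>'a\<close>.
  The assumption \<open>component_eq\<close> gives in particular \<open>A 0 = K \<cdot> 1\<close>.
\<close>

locale standard_graded_algebra = vector_space scale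
  for scale :: "'k::field \<Rightarrow> 'a::comm_ring_1 \<Rightarrow> 'a" +
  fixes R :: "'a set" and A :: "nat \<Rightarrow> 'a set"
  assumes scale_mult: "scale c (x * y) = scale c x * y"
    and decomposition:
      "x \<in> R \<longleftrightarrow>
         (\<exists>h. (\<forall>n. h n \<in> A n) \<and> finite {n. h n \<noteq> 0} \<and> x = (\<Sum>n | h n \<noteq> 0. h n))"
    and independence:
      "(\<forall>n. h n \<in> A n) \<Longrightarrow> finite {n. h n \<noteq> 0} \<Longrightarrow> (\<Sum>n | h n \<noteq> 0. h n) = 0 \<Longrightarrow> h n = 0"
    and component_eq: "A n = span (products (A 1) n)"
    and finite_generation: "\<exists>B. finite B \<and> A 1 = span B"
begin

definition irrelevant_ideal :: "'a set" where
  "irrelevant_ideal = span (\<Union>n. A (Suc n))"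

text \<open>
  \<open>free_module b\<close> is \<open>R\<^sup>b\<close>, its elements being extended by \<open>0\<close> to all indices;
  \<open>free_component b e n\<close> is the component of degree \<open>n\<close> when the \<open>j\<close>-th basis
  element has degree \<open>e j\<close>, that is, of the direct sum of the \<open>R(- e j)\<close> for \<open>j < b\<close>.
\<close>

definition free_module :: "nat \<Rightarrow> (nat \<Rightarrow> 'a) set" where
  "free_module b = {v. (\<forall>j<b. v j \<in> R) \<and> (\<forall>j\<ge>b. v j = 0)}"

definition free_component :: "nat \<Rightarrow> (nat \<Rightarrow> nat) \<Rightarrow> nat \<Rightarrow> (nat \<Rightarrow> 'a) set" where
  "free_component b e n =
     {v. (\<forall>j<b. v j \<in> (if e j \<le> n then A (n - e j) else {0})) \<and> (\<forall>j\<ge>b. v j = 0)}"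

definition graded_hom ::
    "nat \<Rightarrow> (nat \<Rightarrow> nat) \<Rightarrow> nat \<Rightarrow> (nat \<Rightarrow> nat) \<Rightarrow> ((nat \<Rightarrow> 'a) \<Rightarrow> nat \<Rightarrow> 'a) \<Rightarrow> bool" where
  "graded_hom b e b' e' d \<longleftrightarrow>
     d ` free_module b \<subseteq> free_module b' \<and>
     (\<forall>u\<in>free_module b. \<forall>v\<in>free_module b. d (\<lambda>j. u j + v j) = (\<lambda>j. d u j + d v j)) \<and>
     (\<forall>r\<in>R. \<forall>v\<in>free_module b. d (\<lambda>j. r * v j) = (\<lambda>j. r * d v j)) \<and>
     (\<forall>n. d ` free_component b e n \<subseteq> free_component b' e' n)"

text \<open>
  A surjective homogeneous \<open>R\<close>-linear map onto the residue field \<open>K = R / irrelevant_ideal\<close>,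
  which is concentrated in degree \<open>0\<close>: an element \<open>r\<close> of \<open>R\<close> acts on \<open>K\<close> as multiplication
  by its residue, the scalar \<open>c\<close> with \<open>r - c \<cdot> 1\<close> in the irrelevant ideal.
\<close>

definition graded_augmentation ::
    "nat \<Rightarrow> (nat \<Rightarrow> nat) \<Rightarrow> ((nat \<Rightarrow> 'a) \<Rightarrow> 'k) \<Rightarrow> bool" where
  "graded_augmentation b e \<epsilon> \<longleftrightarrow>
     \<epsilon> ` free_module b = UNIV \<and>
     (\<forall>u\<in>free_module b. \<forall>v\<in>free_module b. \<epsilon> (\<lambda>j. u j + v j) = \<epsilon> u + \<epsilon> v) \<and>
     (\<forall>r\<in>R. \<forall>c. r - scale c 1 \<in> irrelevant_ideal \<longrightarrow>
        (\<forall>v\<in>free_module b. \<epsilon> (\<lambda>j. r * v j) = c * \<epsilon> v)) \<and>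
     (\<forall>n>0. \<forall>v\<in>free_component b e n. \<epsilon> v = 0)"

text \<open>
  The \<open>i\<close>-th module \<open>F\<^sub>i\<close> of the resolution has rank \<open>b i\<close> and basis degrees \<open>e i\<close>,
  and \<open>d i\<close> maps \<open>F\<^sub>i\<^sub>+\<^sub>1\<close> to \<open>F\<^sub>i\<close>.
\<close>

definition graded_free_resolution ::
    "(nat \<Rightarrow> nat) \<Rightarrow> (nat \<Rightarrow> nat \<Rightarrow> nat) \<Rightarrow> (nat \<Rightarrow> (nat \<Rightarrow> 'a) \<Rightarrow> nat \<Rightarrow> 'a) \<Rightarrow>
     ((nat \<Rightarrow> 'a) \<Rightarrow> 'k) \<Rightarrow> bool" where
  "graded_free_resolution b e d \<epsilon> \<longleftrightarrow>
     graded_augmentation (b 0) (e 0) \<epsilon> \<and>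
     (\<forall>i. graded_hom (b (Suc i)) (e (Suc i)) (b i) (e i) (d i)) \<and>
     {v \<in> free_module (b 0). \<epsilon> v = 0} = d 0 ` free_module (b 1) \<and>
     (\<forall>i. {v \<in> free_module (b (Suc i)). d i v = (\<lambda>_. 0)} =
            d (Suc i) ` free_module (b (Suc (Suc i))))"

definition linear_degrees :: "(nat \<Rightarrow> nat) \<Rightarrow> (nat \<Rightarrow> nat \<Rightarrow> nat) \<Rightarrow> bool" where
  "linear_degrees b e \<longleftrightarrow> (\<forall>i. \<forall>j<b i. e i j = i)"

end

locale koszul_algebra = standard_graded_algebra +
  assumes linear_resolution:
    "\<exists>b e d \<epsilon>. graded_free_resolution b e d \<epsilon> \<and> linear_degrees b e"


section \<open>The polynomial ring \<open>S[t]\<close>\<close>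

datatype 'p xy_var = X 'p | Y 'p

text \<open>
  The library provides the integral domain instance for polynomials in several variables only
  over linearly ordered variables; an arbitrary well-ordering is fixed for this purpose alone.
\<close>

instantiation xy_var :: (type) linorder
begin

definition less_eq_xy_var :: "'a xy_var \<Rightarrow> 'a xy_var \<Rightarrow> bool" where
  "less_eq_xy_var v w \<longleftrightarrow> (v, w) \<in> (SOME r. well_order_on UNIV r)"

definition less_xy_var :: "'a xy_var \<Rightarrow> 'a xy_var \<Rightarrow> bool" where
  "less_xy_var v w \<longleftrightarrow> v \<le> w \<and> \<not> w \<le> v"

instance
proof -
  have "\<exists>r :: 'a xy_var rel. well_order_on UNIV r"
    by (rule well_order_on)
  then have "well_order_on UNIV (SOME r :: 'a xy_var rel. well_order_on UNIV r)"
    by (rule someI_ex)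
  then have lin: "linear_order_on UNIV (SOME r :: 'a xy_var rel. well_order_on UNIV r)"
    by (simp add: well_order_on_def)
  show "OFCLASS('a xy_var, linorder_class)"
  proof
    fix u v w :: "'a xy_var"
    show "u < v \<longleftrightarrow> u \<le> v \<and> \<not> v \<le> u"
      by (rule less_xy_var_def)
    show "u \<le> u"
      using lin by (auto simp: less_eq_xy_var_def linear_order_on_def partial_order_on_def
          preorder_on_def refl_on_def)
    show "u \<le> v \<Longrightarrow> v \<le> w \<Longrightarrow> u \<le> w"
      using lin unfolding less_eq_xy_var_def linear_order_on_def partial_order_on_def
        preorder_on_def by (blast dest: transD)
    show "u \<le> v \<Longrightarrow> v \<le> u \<Longrightarrow> u = v"
      using lin unfolding less_eq_xy_var_def linear_order_on_def partial_order_on_def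
      by (blast dest: antisymD)
    show "u \<le> v \<or> v \<le> u"
      using lin unfolding less_eq_xy_var_def linear_order_on_def partial_order_on_def
        preorder_on_def total_on_def refl_on_def by (cases "u = v") auto
  qed
qed

end

text \<open>
  The poset is a subset \<open>P\<close> of a type \<open>'p\<close>. The ring \<open>('p, 'k) mpoly_xy\<close> has variables for
  all elements of \<open>'p\<close>, but only those for elements of \<open>P\<close> enter the Rees algebra.
\<close>

type_synonym ('p, 'k) mpoly_xy = "('p xy_var \<Rightarrow>\<^sub>0 nat) \<Rightarrow>\<^sub>0 'k"

definition var :: "'p xy_var \<Rightarrow> ('p, 'k::field) mpoly_xy" where
  "var v = Poly_Mapping.single (Poly_Mapping.single v 1) 1"

definition scale_K :: "'k::field \<Rightarrow> ('p, 'k) mpoly_xy poly \<Rightarrow> ('p, 'k) mpoly_xy poly" where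
  "scale_K c f = smult (Poly_Mapping.single 0 c) f"


section \<open>The Rees algebra\<close>

definition poset_ideals :: "'p set \<Rightarrow> 'p rel \<Rightarrow> 'p set set" where
  "poset_ideals P r = {I. I \<subseteq> P \<and> (\<forall>x\<in>I. \<forall>y\<in>P. (y, x) \<in> r \<longrightarrow> y \<in> I)}"

definition u_monomial :: "'p set \<Rightarrow> 'p set \<Rightarrow> ('p, 'k::field) mpoly_xy" where
  "u_monomial P I = (\<Prod>p\<in>I. var (X p)) * (\<Prod>p\<in>P - I. var (Y p))"

definition rees_generators :: "'p set \<Rightarrow> 'p rel \<Rightarrow> ('p, 'k::field) mpoly_xy poly set" where
  "rees_generators P r =
     (\<lambda>p. [:var (X p):]) ` P \<union> (\<lambda>p. [:var (Y p):]) ` P \<union>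
     (\<lambda>I. monom (u_monomial P I) 1) ` poset_ideals P r"

inductive_set subalgebra_generated ::
    "('k::field \<Rightarrow> 'a::comm_ring_1 \<Rightarrow> 'a) \<Rightarrow> 'a set \<Rightarrow> 'a set"
  for scale :: "'k::field \<Rightarrow> 'a::comm_ring_1 \<Rightarrow> 'a" and G :: "'a set" where
  one: "1 \<in> subalgebra_generated scale G"
| generator: "g \<in> G \<Longrightarrow> g \<in> subalgebra_generated scale G"
| scale: "f \<in> subalgebra_generated scale G \<Longrightarrow> scale c f \<in> subalgebra_generated scale G"
| add: "f \<in> subalgebra_generated scale G \<Longrightarrow> g \<in> subalgebra_generated scale G \<Longrightarrow>
    f + g \<in> subalgebra_generated scale G"
| mult: "f \<in> subalgebra_generated scale G \<Longrightarrow> g \<in> subalgebra_generated scale G \<Longrightarrow>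
    f * g \<in> subalgebra_generated scale G"

definition rees_algebra :: "'p set \<Rightarrow> 'p rel \<Rightarrow> ('p, 'k::field) mpoly_xy poly set" where
  "rees_algebra P r = subalgebra_generated scale_K (rees_generators P r)"

text \<open>The grading in which all the generators have degree \<open>1\<close>.\<close>

definition rees_component :: "'p set \<Rightarrow> 'p rel \<Rightarrow> nat \<Rightarrow> ('p, 'k::field) mpoly_xy poly set" where
  "rees_component P r n = module.span scale_K (products (rees_generators P r) n)"

end

theory Submission
  imports Defs "HOL-Library.Product_Plus" "HOL-Library.Product_Lexorder"
begin

text \<open>
  A monomial \<open>x\<^sup>a y\<^sup>b t\<^sup>k\<close> lies in the Rees algebra \<open>R\<close> iff \<open>a\<^sub>p + b\<^sub>q \<ge> k\<close> for all \<open>p \<le> q\<close> in \<open>P\<close>: if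
  \<open>k > 0\<close>, it is divisible by \<open>u\<^sub>I t\<close> for the largest ideal \<open>I\<close> contained in the support of \<open>a\<close>.
  So \<open>R\<close> is the algebra of a saturated semigroup. For normality, if \<open>f / g\<close> is integral, then
  \<open>d f\<^sup>i\<close> is divisible by \<open>g\<^sup>i\<close> in \<open>R\<close> for a fixed \<open>d\<close> and all \<open>i\<close>. Comparing leading monomials
  in each of the defining inequalities shows that the leading monomial of \<open>g\<close> divides that of
  \<open>f\<close>, and one can subtract a multiple of \<open>g\<close> from \<open>f\<close> and proceed by induction.

  For Koszulness, let \<open>Q\<close> be an up-closed set of ideals of \<open>P\<close>. The ideals of \<open>R\<close> generated by the
  \<open>u\<^sub>I t\<close> with \<open>I \<in> Q\<close>, by variables \<open>x\<^sub>p\<close> such that \<open>Q\<close> contains all \<open>I\<close> with \<open>p \<in> I\<close>, and, if \<open>Q\<close>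
  contains all ideals, by some \<open>y\<^sub>p\<close>, form a Koszul filtration in the sense of Conca, Trung and
  Valla: they can be built up by one generator at a time, all colon ideals being in the family.
\<close>

section \<open>Graded components\<close>

text \<open>Divisibility in \<open>R\<close> is subtler than in a polynomial ring:
  \<open>x\<^sub>p\<close> divides a monomial of \<open>R\<close> only if it occurs in it and no
  inequality at a pair \<open>p \<le> q\<close> is tight. If \<open>x\<^sub>p\<close> occurs and the
  inequality at \<open>(p, q)\<close> is tight, then every \<open>x\<^sub>s\<close> with
  \<open>s \<le> p\<close> occurs as well, so some \<open>u\<^sub>I t\<close> with
  \<open>p \<in> I\<close> divides. This is why \<open>x\<^sub>p\<close> comes only with all these
  \<open>u\<^sub>I t\<close>: membership in the ideal generated by them and \<open>x\<^sub>p\<close>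
  then just means that \<open>x\<^sub>p\<close> occurs. Multiplication by a \<open>y\<^sub>q\<close>
  can loosen tight inequalities and so create divisibility by some \<open>x\<^sub>p\<close>; this is
  harmless in \<open>t\<close>-degree 0, and the other degrees are covered once all
  \<open>u\<^sub>I t\<close> are present. A Koszul filtration speaks of ideals, while syzygies live
  in free modules of higher rank. The property carried through the resolution is therefore a list of
  linear generators whose successive cyclic quotients have annihilators in the family. For
  normality, integrality is traded for a common denominator \<open>d\<close> of all powers of
  \<open>f / g\<close>, because this survives, with the same \<open>d\<close>, the subtraction of a
  multiple of \<open>g\<close> from \<open>f\<close>.\<close>

context standard_graded_algebra
begin

lemma scale_mult_right: "scale c (x * y) = x * scale c y"
  using scale_mult[of c y x] by (simp add: mult.commute)

lemma subspace_A: "subspace (A n)"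
  by (subst component_eq) (rule subspace_span)

lemma zero_in_A [simp]: "0 \<in> A n"
  by (rule subspace_0[OF subspace_A])

lemma A_0: "A 0 = span {1}"
  by (subst component_eq) (simp add: products_def)

lemma A_mult:
  assumes "x \<in> A m" and "y \<in> A n"
  shows "x * y \<in> A (m + n)"
proof -
  have prods: "g * h \<in> A (m + n)"
    if "g \<in> products (A 1) m" and "h \<in> products (A 1) n" for g h
  proof -
    obtain gs hs where "g = prod_list gs" "length gs = m" "set gs \<subseteq> A 1"
      and "h = prod_list hs" "length hs = n" "set hs \<subseteq> A 1"
      using \<open>g \<in> products (A 1) m\<close> \<open>h \<in> products (A 1) n\<close> by (auto simp: products_def)
    then have "g * h = prod_list (gs @ hs) \<and> length (gs @ hs) = m + n \<and> set (gs @ hs) \<subseteq> A 1"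
      by simp
    then have "g * h \<in> products (A 1) (m + n)"
      unfolding products_def by blast
    then show ?thesis
      by (subst component_eq) (rule span_base)
  qed
  have right: "g * y \<in> A (m + n)" if "g \<in> products (A 1) m" for g
  proof -
    have "y \<in> span (products (A 1) n)"
      using assms(2) by (subst (asm) component_eq)
    then show ?thesis
    proof (induction rule: span_induct_alt)
      case base
      then show ?case by simp
    next
      case (step c h y)
      then show ?case
        using prods[OF that] subspace_A[of "m + n"]
        by (simp add: distrib_left scale_mult_right[symmetric] subspace_add subspace_scale)
    qed
  qed
  have "x \<in> span (products (A 1) m)"
    using assms(1) by (subst (asm) component_eq)
  then show ?thesis
  proof (induction rule: span_induct_alt)
    case base
    then show ?case by simp
  next
    case (step c g x)
    then show ?case
      using right subspace_A[of "m + n"]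
      by (simp add: distrib_right scale_mult[symmetric] subspace_add subspace_scale)
  qed
qed

lemma sum_in_R:
  assumes "finite S" and "\<And>n. n \<in> S \<Longrightarrow> h n \<in> A n"
  shows "(\<Sum>n\<in>S. h n) \<in> R"
proof -
  define h' where "h' n = (if n \<in> S then h n else 0)" for n
  have "(\<Sum>n | h' n \<noteq> 0. h' n) = (\<Sum>n\<in>S. h' n)"
    using assms(1) by (intro sum.mono_neutral_left) (auto simp: h'_def)
  moreover have "\<dots> = (\<Sum>n\<in>S. h n)"
    by (rule sum.cong) (auto simp: h'_def)
  moreover have "finite {n. h' n \<noteq> 0}"
    by (rule finite_subset[OF _ assms(1)]) (auto simp: h'_def)
  moreover have "\<forall>n. h' n \<in> A n"
    using assms(2) by (auto simp: h'_def)
  ultimately show ?thesis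
    unfolding decomposition by (intro exI[of _ h']) simp
qed

lemma A_subset_R: "A n \<subseteq> R"
proof
  fix x assume "x \<in> A n"
  then show "x \<in> R"
    using sum_in_R[of "{n}" "\<lambda>_. x"] by simp
qed

text \<open>Junk outside of \<open>R\<close>.\<close>

definition hcomp :: "'a \<Rightarrow> nat \<Rightarrow> 'a" where
  "hcomp x = (SOME h. (\<forall>n. h n \<in> A n) \<and> finite {n. h n \<noteq> 0} \<and> x = (\<Sum>n | h n \<noteq> 0. h n))"

lemma
  assumes "x \<in> R"
  shows hcomp_in: "hcomp x n \<in> A n"
    and finite_hcomp: "finite {n. hcomp x n \<noteq> 0}"
    and sum_hcomp: "(\<Sum>n | hcomp x n \<noteq> 0. hcomp x n) = x"
proof -
  have "\<exists>h. (\<forall>n. h n \<in> A n) \<and> finite {n. h n \<noteq> 0} \<and> x = (\<Sum>n | h n \<noteq> 0. h n)"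
    using assms by (simp add: decomposition)
  then have "(\<forall>n. hcomp x n \<in> A n) \<and> finite {n. hcomp x n \<noteq> 0} \<and>
      x = (\<Sum>n | hcomp x n \<noteq> 0. hcomp x n)"
    unfolding hcomp_def by (rule someI_ex)
  then show "hcomp x n \<in> A n" and "finite {n. hcomp x n \<noteq> 0}"
    and "(\<Sum>n | hcomp x n \<noteq> 0. hcomp x n) = x" by auto
qed

lemma sum_hcomp_superset:
  assumes "x \<in> R" and "finite S" and "{n. hcomp x n \<noteq> 0} \<subseteq> S"
  shows "(\<Sum>n\<in>S. hcomp x n) = x"
proof -
  have "(\<Sum>n | hcomp x n \<noteq> 0. hcomp x n) = (\<Sum>n\<in>S. hcomp x n)"
    using assms by (intro sum.mono_neutral_left) auto
  then show ?thesis
    using sum_hcomp[OF assms(1)] by simp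
qed

lemma hcomp_eqI:
  assumes "finite S" and "\<And>n. h n \<in> A n" and "\<And>n. n \<notin> S \<Longrightarrow> h n = 0" and "x = (\<Sum>n\<in>S. h n)"
  shows "hcomp x = h"
proof
  fix n
  have "x \<in> R"
    unfolding assms(4) by (rule sum_in_R) (use assms in auto)
  define T where "T = S \<union> {n. hcomp x n \<noteq> 0}"
  have fin: "finite T"
    using assms(1) finite_hcomp[OF \<open>x \<in> R\<close>] by (simp add: T_def)
  define g where "g n = hcomp x n - h n" for n
  have sub: "{n. g n \<noteq> 0} \<subseteq> T"
    using assms(3) by (auto simp: T_def g_def)
  have "(\<Sum>n\<in>T. hcomp x n) = x"
    by (rule sum_hcomp_superset[OF \<open>x \<in> R\<close> fin]) (simp add: T_def)
  moreover have "(\<Sum>n\<in>S. h n) = (\<Sum>n\<in>T. h n)"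
    using fin assms(3) by (intro sum.mono_neutral_left) (auto simp: T_def)
  ultimately have "(\<Sum>n\<in>T. g n) = 0"
    using assms(4) by (simp add: g_def sum_subtractf)
  moreover have "(\<Sum>n | g n \<noteq> 0. g n) = (\<Sum>n\<in>T. g n)"
    using fin sub by (intro sum.mono_neutral_left) auto
  ultimately have "g n = 0"
    using hcomp_in[OF \<open>x \<in> R\<close>] assms(2) finite_subset[OF sub fin]
    by (intro independence[of g]) (auto simp: g_def subspace_diff[OF subspace_A])
  then show "hcomp x n = h n"
    by (simp add: g_def)
qed

lemma hcomp_homogeneous:
  assumes "x \<in> A m"
  shows "hcomp x n = (if n = m then x else 0)"
proof -
  have "hcomp x = (\<lambda>n. if n = m then x else 0)"
    by (rule hcomp_eqI[of "{m}"]) (use assms in auto)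
  then show ?thesis by simp
qed

lemma R_add:
  assumes "x \<in> R" and "y \<in> R"
  shows "x + y \<in> R" and "hcomp (x + y) n = hcomp x n + hcomp y n"
proof -
  define S where "S = {n. hcomp x n \<noteq> 0} \<union> {n. hcomp y n \<noteq> 0}"
  have S: "finite S"
    using finite_hcomp assms by (simp add: S_def)
  have eq: "x + y = (\<Sum>n\<in>S. hcomp x n + hcomp y n)"
    using sum_hcomp_superset[OF assms(1) S] sum_hcomp_superset[OF assms(2) S]
    by (simp add: sum.distrib S_def)
  have A: "hcomp x n + hcomp y n \<in> A n" for n
    using hcomp_in assms by (simp add: subspace_add[OF subspace_A])
  show "x + y \<in> R"
    unfolding eq by (rule sum_in_R[OF S A])
  have "hcomp (x + y) = (\<lambda>n. hcomp x n + hcomp y n)"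
    by (rule hcomp_eqI[OF S A _ eq]) (simp add: S_def)
  then show "hcomp (x + y) n = hcomp x n + hcomp y n" by simp
qed

lemma R_scale:
  assumes "x \<in> R"
  shows "scale c x \<in> R" and "hcomp (scale c x) n = scale c (hcomp x n)"
proof -
  define S where "S = {n. hcomp x n \<noteq> 0}"
  have S: "finite S"
    using finite_hcomp assms by (simp add: S_def)
  have eq: "scale c x = (\<Sum>n\<in>S. scale c (hcomp x n))"
    using sum_hcomp_superset[OF assms S] by (simp add: scale_sum_right[symmetric] S_def)
  have A: "scale c (hcomp x n) \<in> A n" for n
    using hcomp_in assms by (simp add: subspace_scale[OF subspace_A])
  show "scale c x \<in> R"
    unfolding eq by (rule sum_in_R[OF S A])
  have "hcomp (scale c x) = (\<lambda>n. scale c (hcomp x n))"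
    by (rule hcomp_eqI[OF S A _ eq]) (simp add: S_def)
  then show "hcomp (scale c x) n = scale c (hcomp x n)" by simp
qed

lemma homogeneous_mult_R:
  assumes "a \<in> A m" and "x \<in> R"
  shows "a * x \<in> R" and "hcomp (a * x) (m + n) = a * hcomp x n"
    and "n < m \<Longrightarrow> hcomp (a * x) n = 0"
proof -
  define S where "S = {n. hcomp x n \<noteq> 0}"
  have S: "finite S"
    using finite_hcomp assms by (simp add: S_def)
  define h where "h n = (if m \<le> n then a * hcomp x (n - m) else 0)" for n
  have "a * x = (\<Sum>n\<in>S. a * hcomp x n)"
    using sum_hcomp_superset[OF assms(2) S] by (simp add: sum_distrib_left[symmetric] S_def)
  also have "\<dots> = (\<Sum>n\<in>(+) m ` S. h n)"
    by (subst sum.reindex) (auto simp: h_def)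
  finally have eq: "a * x = (\<Sum>n\<in>(+) m ` S. h n)" .
  have A: "h n \<in> A n" for n
    using A_mult[OF assms(1) hcomp_in[OF assms(2), of "n - m"]]
    by (cases "m \<le> n") (simp_all add: h_def)
  show "a * x \<in> R"
    unfolding eq by (rule sum_in_R) (use S A in auto)
  have "hcomp (a * x) = h"
  proof (rule hcomp_eqI[OF _ A _ eq])
    fix n assume "n \<notin> (+) m ` S"
    then have "m \<le> n \<Longrightarrow> hcomp x (n - m) = 0"
      by (force simp: S_def image_iff)
    then show "h n = 0" by (simp add: h_def)
  qed (use S in simp)
  then show "hcomp (a * x) (m + n) = a * hcomp x n"
    and "n < m \<Longrightarrow> hcomp (a * x) n = 0"
    by (simp_all add: h_def)
qed

lemma R_zero [simp]: "0 \<in> R"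
  using A_subset_R zero_in_A by blast

lemma R_sum: "(\<And>i. i \<in> S \<Longrightarrow> f i \<in> R) \<Longrightarrow> (\<Sum>i\<in>S. f i) \<in> R"
  by (induction S rule: infinite_finite_induct) (auto intro: R_add)

lemma R_mult:
  assumes "x \<in> R" and "y \<in> R"
  shows "x * y \<in> R"
proof -
  have "x * y = (\<Sum>n | hcomp x n \<noteq> 0. hcomp x n * y)"
    using sum_hcomp[OF assms(1)] by (simp add: sum_distrib_right[symmetric])
  also have "\<dots> \<in> R"
    by (intro R_sum homogeneous_mult_R[OF hcomp_in] assms)
  finally show ?thesis .
qed

lemma R_uminus: "x \<in> R \<Longrightarrow> - x \<in> R"
  using R_scale(1)[of x "- 1"] by simp

lemma R_one [simp]: "1 \<in> R"
  using A_subset_R[of 0] by (auto simp: A_0 span_base)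

lemma hcomp_sum:
  "(\<And>i. i \<in> S \<Longrightarrow> f i \<in> R) \<Longrightarrow> hcomp (\<Sum>i\<in>S. f i) n = (\<Sum>i\<in>S. hcomp (f i) n)"
proof (induction S rule: infinite_finite_induct)
  case (insert i S)
  then show ?case by (simp add: R_add R_sum)
qed (simp_all add: hcomp_homogeneous[OF zero_in_A[of 0]])

lemma irrelevant_ideal_eq: "irrelevant_ideal = {x \<in> R. hcomp x 0 = 0}"
proof (intro equalityI subsetI)
  fix x assume "x \<in> irrelevant_ideal"
  then have "x \<in> span (\<Union>n. A (Suc n))" by (simp add: irrelevant_ideal_def)
  then show "x \<in> {x \<in> R. hcomp x 0 = 0}"
  proof (induction rule: span_induct_alt)
    case base
    then show ?case using hcomp_homogeneous[OF zero_in_A[of 0]] by simp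
  next
    case (step c g y)
    then obtain n where "g \<in> A (Suc n)" by blast
    then have "g \<in> R" "hcomp g 0 = 0"
      using A_subset_R hcomp_homogeneous by auto
    then show ?case
      using step by (simp add: R_add R_scale)
  qed
next
  fix x assume x: "x \<in> {x \<in> R. hcomp x 0 = 0}"
  have "hcomp x n \<in> span (\<Union>n. A (Suc n))" for n
  proof (cases n)
    case 0
    then show ?thesis using x by (simp add: span_zero)
  next
    case (Suc m)
    then show ?thesis using x hcomp_in[of x n] by (auto intro!: span_base)
  qed
  then have "(\<Sum>n | hcomp x n \<noteq> 0. hcomp x n) \<in> span (\<Union>n. A (Suc n))"
    by (intro span_sum)
  then show "x \<in> irrelevant_ideal"
    using x by (simp add: sum_hcomp irrelevant_ideal_def)
qed

end

section \<open>Koszul filtrations and linear resolutions\<close>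

context standard_graded_algebra
begin

text \<open>The matrix with columns \<open>fs\<close>: its image on \<open>free_module\<close> is
  \<open>gen fs\<close>, its kernel there is the syzygy module, and it later serves as a
  differential. Coordinates of \<open>v\<close> beyond the length of \<open>fs\<close> are
  ignored.\<close>

definition comb :: "(nat \<Rightarrow> 'a) list \<Rightarrow> (nat \<Rightarrow> 'a) \<Rightarrow> nat \<Rightarrow> 'a" where
  "comb fs v = (\<lambda>i. \<Sum>j<length fs. v j * (fs ! j) i)"

definition gen :: "(nat \<Rightarrow> 'a) list \<Rightarrow> (nat \<Rightarrow> 'a) set" where
  "gen fs = comb fs ` free_module (length fs)"

definition ideal :: "'a list \<Rightarrow> 'a set" where
  "ideal gs = {\<Sum>j<length gs. v j * gs ! j | v. v \<in> free_module (length gs)}"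

lemma comb_add: "comb fs (\<lambda>j. u j + v j) = (\<lambda>i. comb fs u i + comb fs v i)"
  by (simp add: comb_def distrib_right sum.distrib)

lemma comb_mult: "comb fs (\<lambda>j. r * v j) = (\<lambda>i. r * comb fs v i)"
  by (simp add: comb_def sum_distrib_left mult.assoc)

lemma comb_uminus: "comb fs (\<lambda>j. - v j) = (\<lambda>i. - comb fs v i)"
  by (simp add: comb_def sum_negf)

lemma comb_zero: "comb fs (\<lambda>j. 0) = (\<lambda>i. 0)"
  by (simp add: comb_def)

lemma comb_cong: "(\<And>j. j < length fs \<Longrightarrow> u j = v j) \<Longrightarrow> comb fs u = comb fs v"
  by (simp add: comb_def)

lemma comb_snoc: "comb (fs @ [f]) v = (\<lambda>i. comb fs v i + v (length fs) * f i)"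
proof
  fix i
  have "(\<Sum>j<length fs. v j * ((fs @ [f]) ! j) i) = (\<Sum>j<length fs. v j * (fs ! j) i)"
    by (rule sum.cong) (auto simp: nth_append)
  then show "comb (fs @ [f]) v i = comb fs v i + v (length fs) * f i"
    by (simp add: comb_def)
qed

lemma free_module_add:
  "u \<in> free_module b \<Longrightarrow> v \<in> free_module b \<Longrightarrow> (\<lambda>j. u j + v j) \<in> free_module b"
  by (auto simp: free_module_def R_add)

lemma free_module_mult: "r \<in> R \<Longrightarrow> v \<in> free_module b \<Longrightarrow> (\<lambda>j. r * v j) \<in> free_module b"
  by (auto simp: free_module_def R_mult)

lemma zero_in_free_module: "(\<lambda>j. 0) \<in> free_module b"
  by (simp add: free_module_def)

lemma genI: "v \<in> free_module (length fs) \<Longrightarrow> comb fs v = x \<Longrightarrow> x \<in> gen fs"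
  by (auto simp: gen_def)

lemma genE:
  assumes "x \<in> gen fs"
  obtains v where "v \<in> free_module (length fs)" and "x = comb fs v"
  using assms by (auto simp: gen_def)

lemma gen_zero: "(\<lambda>i. 0) \<in> gen fs"
  by (rule genI[OF zero_in_free_module comb_zero])

lemma gen_add:
  assumes "x \<in> gen fs" and "y \<in> gen fs"
  shows "(\<lambda>i. x i + y i) \<in> gen fs"
proof -
  obtain u v where u: "u \<in> free_module (length fs)" "x = comb fs u"
    and v: "v \<in> free_module (length fs)" "y = comb fs v"
    using assms by (blast elim: genE)
  show ?thesis
    by (rule genI[OF free_module_add[OF u(1) v(1)]]) (simp add: comb_add u(2) v(2))
qed

lemma gen_mult:
  assumes "r \<in> R" and "x \<in> gen fs"
  shows "(\<lambda>i. r * x i) \<in> gen fs"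
proof -
  obtain v where v: "v \<in> free_module (length fs)" "x = comb fs v"
    using assms(2) by (rule genE)
  show ?thesis
    by (rule genI[OF free_module_mult[OF assms(1) v(1)]]) (simp add: comb_mult v(2))
qed

lemma gen_Nil: "gen [] = {\<lambda>i. 0}"
  using gen_zero[of "[]"] by (auto simp: gen_def comb_def)

lemma gen_snoc: "gen (fs @ [f]) = {\<lambda>i. x i + r * f i | x r. x \<in> gen fs \<and> r \<in> R}"
proof (intro equalityI subsetI)
  fix y assume "y \<in> gen (fs @ [f])"
  then obtain v where v: "v \<in> free_module (Suc (length fs))" and y: "y = comb (fs @ [f]) v"
    by (auto simp: gen_def)
  define u where "u j = (if j < length fs then v j else 0)" for j
  have "u \<in> free_module (length fs)" and "v (length fs) \<in> R"
    using v by (auto simp: u_def free_module_def)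
  moreover have "comb fs v = comb fs u"
    by (rule comb_cong) (simp add: u_def)
  ultimately show "y \<in> {\<lambda>i. x i + r * f i | x r. x \<in> gen fs \<and> r \<in> R}"
    unfolding y comb_snoc gen_def by auto
next
  fix y assume "y \<in> {\<lambda>i. x i + r * f i | x r. x \<in> gen fs \<and> r \<in> R}"
  then obtain u r where u: "u \<in> free_module (length fs)" and r: "r \<in> R"
    and y: "y = (\<lambda>i. comb fs u i + r * f i)"
    by (auto simp: gen_def)
  define v where "v = u(length fs := r)"
  have "v \<in> free_module (length (fs @ [f]))"
    using u r by (auto simp: v_def free_module_def)
  moreover have "comb fs v = comb fs u"
    by (rule comb_cong) (simp add: v_def)
  then have "y = comb (fs @ [f]) v"
    unfolding y comb_snoc by (simp add: v_def)
  ultimately show "y \<in> gen (fs @ [f])"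
    unfolding gen_def by blast
qed

lemma gen_append: "gen (fs @ gs) = {\<lambda>i. x i + y i | x y. x \<in> gen fs \<and> y \<in> gen gs}"
proof (induction gs rule: rev_induct)
  case Nil
  then show ?case by (auto simp: gen_Nil)
next
  case (snoc g gs)
  have "gen (fs @ gs @ [g]) =
      {\<lambda>i. z i + r * g i | z r. z \<in> {\<lambda>i. x i + y i | x y. x \<in> gen fs \<and> y \<in> gen gs} \<and> r \<in> R}"
    using gen_snoc[of "fs @ gs" g] snoc by simp
  also have "\<dots> = {\<lambda>i. x i + (y i + r * g i) | x y r. x \<in> gen fs \<and> y \<in> gen gs \<and> r \<in> R}"
    (is "?S = ?T")
  proof (intro equalityI subsetI)
    fix w assume "w \<in> ?S"
    then show "w \<in> ?T" by (auto simp: add.assoc) blast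
  next
    fix w assume "w \<in> ?T"
    then obtain x y r where "x \<in> gen fs" "y \<in> gen gs" "r \<in> R"
      "w = (\<lambda>i. (x i + y i) + r * g i)" by (auto simp: add.assoc)
    then show "w \<in> ?S"
      by (intro CollectI exI[of _ "\<lambda>i. x i + y i"] exI[of _ r]) auto
  qed
  also have "\<dots> = {\<lambda>i. x i + y i | x y. x \<in> gen fs \<and> y \<in> gen (gs @ [g])}"
    unfolding gen_snoc by fastforce
  finally show ?case .
qed

lemma idealI:
  assumes "v \<in> free_module (length gs)" and "x = (\<Sum>j<length gs. v j * gs ! j)"
  shows "x \<in> ideal gs"
  unfolding ideal_def using assms by (intro CollectI exI[of _ v] conjI)

lemma ideal_base:
  assumes "g \<in> set gs"
  shows "g \<in> ideal gs"
proof -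
  obtain l where l: "l < length gs" "gs ! l = g"
    using assms by (auto simp: in_set_conv_nth)
  have "(\<Sum>j<length gs. (if j = l then 1 else 0) * gs ! j) =
      (\<Sum>j<length gs. if l = j then gs ! j else 0)"
    by (rule sum.cong) auto
  also have "\<dots> = g" using l by simp
  finally have "g = (\<Sum>j<length gs. (if j = l then 1 else 0) * gs ! j)" ..
  moreover have "(\<lambda>j. if j = l then 1 else 0) \<in> free_module (length gs)"
    using l by (auto simp: free_module_def)
  ultimately show ?thesis
    by (intro idealI[of "\<lambda>j. if j = l then 1 else 0"])
qed

lemma ideal_mult:
  assumes "r \<in> R" and "x \<in> ideal gs"
  shows "r * x \<in> ideal gs"
proof -
  obtain v where v: "v \<in> free_module (length gs)" and x: "x = (\<Sum>j<length gs. v j * gs ! j)"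
    using assms(2) by (auto simp: ideal_def)
  have "r * x = (\<Sum>j<length gs. (r * v j) * gs ! j)"
    by (simp add: x sum_distrib_left mult.assoc)
  then show ?thesis
    by (rule idealI[OF free_module_mult[OF assms(1) v]])
qed

lemma ideal_add:
  assumes "x \<in> ideal gs" and "y \<in> ideal gs"
  shows "x + y \<in> ideal gs"
proof -
  obtain u v where u: "u \<in> free_module (length gs)" "x = (\<Sum>j<length gs. u j * gs ! j)"
    and v: "v \<in> free_module (length gs)" "y = (\<Sum>j<length gs. v j * gs ! j)"
    using assms by (auto simp: ideal_def)
  have "x + y = (\<Sum>j<length gs. (u j + v j) * gs ! j)"
    by (simp add: u(2) v(2) distrib_right sum.distrib)
  then show ?thesis
    by (rule idealI[OF free_module_add[OF u(1) v(1)]])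
qed

lemma gen_free_module:
  assumes "\<And>f. f \<in> set fs \<Longrightarrow> f \<in> free_module b"
  shows "gen fs \<subseteq> free_module b"
proof
  fix x assume "x \<in> gen fs"
  then obtain v where v: "v \<in> free_module (length fs)" and x: "x = comb fs v"
    by (auto simp: gen_def)
  have fs: "fs ! j \<in> free_module b" if "j < length fs" for j
    using assms that by simp
  have "x i \<in> R" if "i < b" for i
    unfolding x comb_def using v fs that by (intro R_sum R_mult) (auto simp: free_module_def)
  moreover have "x i = 0" if "b \<le> i" for i
    unfolding x comb_def using fs that by (intro sum.neutral) (auto simp: free_module_def)
  ultimately show "x \<in> free_module b"
    by (simp add: free_module_def)
qed

text \<open>
  A Koszul filtration, given by lists of generators of the ideals rather than by the ideals
  themselves.
\<close>

definition koszul_filtration :: "'a list set \<Rightarrow> bool" where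
  "koszul_filtration F \<longleftrightarrow>
     (\<forall>gs\<in>F. set gs \<subseteq> A 1 \<and>
        (\<forall>l<length gs. \<exists>gs'\<in>F. \<forall>r\<in>R. r * gs ! l \<in> ideal (take l gs) \<longleftrightarrow> r \<in> ideal gs'))"

text \<open>The successive quotients of the submodules \<open>gen (take l fs)\<close> are cyclic
  with annihilators in the family. Unlike membership in \<open>F\<close>, this makes sense in a free
  module of any rank \<open>b\<close>, and it is inherited by syzygies. Linear entries are included
  because each differential must raise degrees by exactly 1.\<close>

definition filtered :: "'a list set \<Rightarrow> nat \<Rightarrow> (nat \<Rightarrow> 'a) list \<Rightarrow> bool" where
  "filtered F b fs \<longleftrightarrow>
     (\<forall>f\<in>set fs. \<forall>i. f i \<in> (if i < b then A 1 else {0})) \<and>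
     (\<forall>l<length fs. \<exists>gs\<in>F. \<forall>r\<in>R. (\<lambda>i. r * (fs ! l) i) \<in> gen (take l fs) \<longleftrightarrow> r \<in> ideal gs)"

lemma filtered_free_module: "filtered F b fs \<Longrightarrow> f \<in> set fs \<Longrightarrow> f \<in> free_module b"
  unfolding free_module_def
proof (intro CollectI conjI allI impI)
  assume "filtered F b fs" and "f \<in> set fs"
  then have f: "f i \<in> (if i < b then A 1 else {0})" for i
    unfolding filtered_def by blast
  show "f j \<in> R" if "j < b" for j
    using f[of j] A_subset_R[of 1] that by auto
  show "f j = 0" if "b \<le> j" for j
    using f[of j] that by simp
qed

lemma filtered_snoc:
  "filtered F b (fs @ [f]) \<longleftrightarrow> filtered F b fs \<and> (\<forall>i. f i \<in> (if i < b then A 1 else {0})) \<and>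
     (\<exists>gs\<in>F. \<forall>r\<in>R. (\<lambda>i. r * f i) \<in> gen fs \<longleftrightarrow> r \<in> ideal gs)"
  (is "_ \<longleftrightarrow> _ \<and> _ \<and> ?last")
proof -
  have "(\<forall>l<length (fs @ [f]). Q l) \<longleftrightarrow> (\<forall>l<length fs. Q l) \<and> Q (length fs)" for Q
    by (auto simp: less_Suc_eq)
  then show ?thesis
    unfolding filtered_def by (simp add: nth_append) blast
qed

text \<open>As the entries of \<open>fs\<close> are linear, only the degree 1 parts of the
  coefficients contribute in degree 2. Passing to these parts keeps the lifted syzygies
  linear.\<close>

lemma gen_linear_lift:
  assumes fs: "\<forall>f\<in>set fs. \<forall>i. f i \<in> A 1"
    and x: "x \<in> gen fs" and x2: "\<And>i. x i \<in> A 2"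
  obtains c where "\<And>j. c j \<in> (if j < length fs then A 1 else {0})" and "comb fs c = x"
proof -
  obtain v where v: "v \<in> free_module (length fs)" and xv: "x = comb fs v"
    using x by (auto simp: gen_def)
  define c where "c j = (if j < length fs then hcomp (v j) 1 else 0)" for j
  have vR: "v j \<in> R" if "j < length fs" for j
    using v that by (simp add: free_module_def)
  have "comb fs c i = x i" for i
  proof -
    have in_R: "(fs ! j) i * v j \<in> R" if "j < length fs" for j
      using homogeneous_mult_R(1)[of "(fs ! j) i" 1, OF _ vR[OF that]] fs that by simp
    have "x i = hcomp (x i) 2"
      using hcomp_homogeneous[OF x2] by simp
    also have "\<dots> = hcomp (\<Sum>j<length fs. (fs ! j) i * v j) 2"
      by (simp add: xv comb_def mult.commute)
    also have "\<dots> = (\<Sum>j<length fs. hcomp ((fs ! j) i * v j) (1 + 1))"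
      by (subst hcomp_sum) (use in_R in \<open>auto simp: numeral_2_eq_2\<close>)
    also have "\<dots> = (\<Sum>j<length fs. c j * (fs ! j) i)"
    proof (rule sum.cong)
      fix j assume "j \<in> {..<length fs}"
      then show "hcomp ((fs ! j) i * v j) (1 + 1) = c j * (fs ! j) i"
        using homogeneous_mult_R(2)[OF _ vR, of "(fs ! j) i" 1 j 1] fs
        by (simp add: c_def mult.commute)
    qed simp
    finally show ?thesis by (simp add: comb_def)
  qed
  moreover have "c j \<in> (if j < length fs then A 1 else {0})" for j
    using hcomp_in[OF vR] by (simp add: c_def)
  ultimately show ?thesis
    by (intro that[of c]) auto
qed

text \<open>
  The syzygies of \<open>fs @ [f]\<close> are filtered by the syzygies of \<open>fs\<close>, and the quotient is the
  colon ideal of \<open>f\<close>, read off in the last coordinate. Lifting its generators \<open>gs\<close> to syzygies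
  therefore prolongs a generating list for the syzygies of \<open>fs\<close>, and the new colon ideals
  are those of \<open>gs\<close>.
\<close>

lemma filtered_syzygies:
  assumes F: "koszul_filtration F" and "filtered F b fs"
  shows "\<exists>hs. filtered F (length fs) hs \<and>
    gen hs = {v \<in> free_module (length fs). comb fs v = (\<lambda>_. 0)}"
  using assms(2)
proof (induction fs rule: rev_induct)
  case Nil
  have "filtered F 0 [] \<and> gen [] = {v \<in> free_module 0. comb [] v = (\<lambda>_. 0)}"
    by (auto simp: filtered_def gen_Nil free_module_def comb_def)
  then show ?case by auto
next
  case (snoc f fs)
  define n where "n = length fs"
  have fs: "filtered F b fs" and f: "\<And>i. f i \<in> (if i < b then A 1 else {0})"
    using snoc.prems by (auto simp: filtered_snoc)
  have fA: "f i \<in> A 1" for i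
    using f[of i] by (auto split: if_splits)
  have fsA: "\<forall>h\<in>set fs. \<forall>i. h i \<in> A 1"
  proof (intro ballI allI)
    fix h i assume "h \<in> set fs"
    then have "h i \<in> (if i < b then A 1 else {0})"
      using fs unfolding filtered_def by blast
    then show "h i \<in> A 1" by (auto split: if_splits)
  qed
  obtain gs where "gs \<in> F" and colon: "\<And>r. r \<in> R \<Longrightarrow> (\<lambda>i. r * f i) \<in> gen fs \<longleftrightarrow> r \<in> ideal gs"
    using snoc.prems by (auto simp: filtered_snoc)
  have gsA: "set gs \<subseteq> A 1"
    and gsF: "\<And>l. l < length gs \<Longrightarrow>
      \<exists>gs'\<in>F. \<forall>r\<in>R. r * gs ! l \<in> ideal (take l gs) \<longleftrightarrow> r \<in> ideal gs'"
    using F \<open>gs \<in> F\<close> by (auto simp: koszul_filtration_def)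
  obtain hs where hs: "filtered F n hs"
    and gen_hs: "gen hs = {v \<in> free_module n. comb fs v = (\<lambda>_. 0)}"
    using snoc.IH[OF fs] by (auto simp: n_def)
  have "\<exists>h. (\<forall>i. h i \<in> (if i < Suc n then A 1 else {0})) \<and> h n = g \<and>
      comb (fs @ [f]) h = (\<lambda>_. 0)" if "g \<in> set gs" for g
  proof -
    have "g \<in> A 1" using gsA that by blast
    have "g \<in> ideal gs"
      by (rule ideal_base[OF \<open>g \<in> set gs\<close>])
    then have "(\<lambda>i. g * f i) \<in> gen fs"
      using colon \<open>g \<in> A 1\<close> A_subset_R by blast
    moreover have "g * f i \<in> A 2" for i
      using A_mult[OF \<open>g \<in> A 1\<close> fA[of i]] by (simp add: numeral_2_eq_2)
    ultimately obtain c where c: "\<And>j. c j \<in> (if j < length fs then A 1 else {0})"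
      "comb fs c = (\<lambda>i. g * f i)"
      by (rule gen_linear_lift[OF fsA]) blast
    \<comment> \<open>The syzygy \<open>(-c, g)\<close> encodes the relation expressing
      \<open>g * f\<close> through \<open>fs\<close>.\<close>
    define h where "h = (\<lambda>j. - c j)(n := g)"
    have "comb fs h = comb fs (\<lambda>j. - c j)"
      by (rule comb_cong) (simp add: h_def n_def)
    then have "comb (fs @ [f]) h = (\<lambda>_. 0)"
      by (simp add: comb_snoc comb_uminus c(2)) (simp add: h_def n_def)
    moreover have "h i \<in> (if i < Suc n then A 1 else {0})" for i
      using c(1)[of i] \<open>g \<in> A 1\<close> by (auto simp: h_def n_def subspace_neg[OF subspace_A])
    ultimately show ?thesis
      by (intro exI[of _ h]) (simp add: h_def)
  qed
  then obtain lift where lift: "\<And>g i. g \<in> set gs \<Longrightarrow> lift g i \<in> (if i < Suc n then A 1 else {0})"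
    and lift_n: "\<And>g. g \<in> set gs \<Longrightarrow> lift g n = g"
    and lift_syz: "\<And>g. g \<in> set gs \<Longrightarrow> comb (fs @ [f]) (lift g) = (\<lambda>_. 0)"
    by metis
  define hs' where "hs' = map lift gs"
  have hs_n: "x n = 0" and hs_free: "x \<in> free_module (Suc n)"
    and hs_syz: "comb (fs @ [f]) x = (\<lambda>_. 0)" if "x \<in> gen hs" for x
  proof -
    have x: "x \<in> free_module n" "comb fs x = (\<lambda>_. 0)"
      using that gen_hs by auto
    then show "x n = 0" and "x \<in> free_module (Suc n)"
      by (auto simp: free_module_def not_less_eq_eq[symmetric] less_Suc_eq)
    then show "comb (fs @ [f]) x = (\<lambda>_. 0)"
      using x by (simp add: comb_snoc n_def)
  qed
  have lift_free: "lift g \<in> free_module (Suc n)" if "g \<in> set gs" for g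
    unfolding free_module_def
  proof (intro CollectI conjI allI impI)
    show "lift g j \<in> R" if "j < Suc n" for j
      using lift[OF \<open>g \<in> set gs\<close>, of j] A_subset_R[of 1] that by auto
    show "lift g j = 0" if "Suc n \<le> j" for j
      using lift[OF \<open>g \<in> set gs\<close>, of j] that by auto
  qed
  have syz_sub: "gen (take l hs') \<subseteq> {v \<in> free_module (Suc n). comb (fs @ [f]) v = (\<lambda>_. 0)}"
    if "l \<le> length gs" for l
    using that
  proof (induction l)
    case 0
    then show ?case by (simp add: gen_Nil zero_in_free_module comb_zero)
  next
    case (Suc l)
    then have "gs ! l \<in> set gs" by simp
    then show ?case
      using Suc lift_free lift_syz
      by (auto simp: hs'_def take_Suc_conv_app_nth gen_snoc comb_add comb_mult
          free_module_add free_module_mult)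
  qed
  have last_coordinate: "ideal (take l gs) = (\<lambda>x. x n) ` gen (take l hs')" if "l \<le> length gs" for l
  proof -
    have "comb (take l hs') v n = (\<Sum>j<length (take l gs). v j * take l gs ! j)" for v
      using that by (auto simp: comb_def hs'_def lift_n intro!: sum.cong)
    then show ?thesis
      using that unfolding ideal_def gen_def by (auto simp: hs'_def image_image)
  qed
  have ker_n: "x \<in> gen hs" if "x \<in> free_module (Suc n)" "comb (fs @ [f]) x = (\<lambda>_. 0)" "x n = 0" for x
  proof -
    have "x \<in> free_module n"
      using that(1,3) by (auto simp: free_module_def less_Suc_eq not_less_eq_eq le_less_Suc_eq)
        (metis Suc_leI le_neq_implies_less)
    then show ?thesis
      using that by (simp add: gen_hs comb_snoc n_def)
  qed
  \<comment> \<open>Two syzygies with the same last coordinate differ by a syzygy of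
    \<open>fs\<close>, which lies in \<open>gen hs\<close>; so beyond \<open>hs\<close> membership
    is decided by the last coordinate alone.\<close>
  have gen_iff: "x \<in> gen (hs @ take l hs') \<longleftrightarrow> x n \<in> ideal (take l gs)"
    if l: "l \<le> length gs" and x: "x \<in> free_module (Suc n)" "comb (fs @ [f]) x = (\<lambda>_. 0)" for l x
  proof
    assume "x \<in> gen (hs @ take l hs')"
    then show "x n \<in> ideal (take l gs)"
      using hs_n unfolding gen_append last_coordinate[OF l] by force
  next
    assume "x n \<in> ideal (take l gs)"
    then obtain y where y: "y \<in> gen (take l hs')" "x n = y n"
      using last_coordinate[OF l] by auto
    define z where "z i = x i + (- 1) * y i" for i
    have "z \<in> gen hs"
    proof (rule ker_n)
      show "z \<in> free_module (Suc n)"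
        unfolding z_def using x syz_sub[OF l] y
        by (intro free_module_add free_module_mult) (auto simp: R_uminus)
      show "comb (fs @ [f]) z = (\<lambda>_. 0)"
        unfolding z_def comb_add comb_mult using x syz_sub[OF l] y by auto
      show "z n = 0" using y by (simp add: z_def)
    qed
    moreover have "x = (\<lambda>i. z i + y i)" by (simp add: z_def)
    ultimately show "x \<in> gen (hs @ take l hs')"
      using y unfolding gen_append by blast
  qed
  have "filtered F (Suc n) (hs @ hs')"
    unfolding filtered_def
  proof (intro conjI ballI allI impI)
    fix h i assume "h \<in> set (hs @ hs')"
    then consider "h \<in> set hs" | g where "g \<in> set gs" "h = lift g"
      by (auto simp: hs'_def)
    then show "h i \<in> (if i < Suc n then A 1 else {0})"
    proof cases
      case 1
      then have "h i \<in> (if i < n then A 1 else {0})"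
        using hs unfolding filtered_def by blast
      then show ?thesis by (auto split: if_splits)
    next
      case 2
      then show ?thesis using lift by blast
    qed
  next
    fix k assume k: "k < length (hs @ hs')"
    show "\<exists>gs'\<in>F. \<forall>r\<in>R. (\<lambda>i. r * ((hs @ hs') ! k) i) \<in> gen (take k (hs @ hs')) \<longleftrightarrow> r \<in> ideal gs'"
    proof (cases "k < length hs")
      case True
      then show ?thesis using hs by (auto simp: filtered_def nth_append)
    next
      case False
      define l where "l = k - length hs"
      have l: "l < length gs" and kl: "k = length hs + l"
        using k False by (auto simp: l_def hs'_def)
      have g: "gs ! l \<in> set gs" using l by simp
      obtain gs' where gs': "gs' \<in> F" "\<forall>r\<in>R. r * gs ! l \<in> ideal (take l gs) \<longleftrightarrow> r \<in> ideal gs'"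
        using gsF[OF l] by blast
      \<comment> \<open>The last coordinate of the lift of \<open>gs ! l\<close> is
        \<open>gs ! l\<close>, so the colon in the module is the colon ideal supplied by the
        filtration.\<close>
      have "(\<lambda>i. r * lift (gs ! l) i) \<in> gen (hs @ take l hs') \<longleftrightarrow> r \<in> ideal gs'" if "r \<in> R" for r
        using that gs'(2) l lift_n[OF g] lift_syz[OF g] lift_free[OF g]
        by (subst gen_iff) (auto simp: comb_mult free_module_mult)
      then show ?thesis
        using gs'(1) l by (intro bexI[of _ gs']) (auto simp: kl nth_append hs'_def)
    qed
  qed
  moreover have "gen (hs @ hs') = {v \<in> free_module (Suc n). comb (fs @ [f]) v = (\<lambda>_. 0)}"
  proof (intro equalityI subsetI)
    fix x assume "x \<in> gen (hs @ hs')"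
    then obtain y z where "x = (\<lambda>i. y i + z i)" and y: "y \<in> gen hs" and z: "z \<in> gen hs'"
      by (auto simp: gen_append)
    moreover have "z \<in> {v \<in> free_module (Suc n). comb (fs @ [f]) v = (\<lambda>_. 0)}"
      using syz_sub[of "length gs"] z by (auto simp: hs'_def)
    ultimately show "x \<in> {v \<in> free_module (Suc n). comb (fs @ [f]) v = (\<lambda>_. 0)}"
      using hs_free hs_syz by (auto simp: comb_add free_module_add)
  next
    fix x assume "x \<in> {v \<in> free_module (Suc n). comb (fs @ [f]) v = (\<lambda>_. 0)}"
    then have x: "x \<in> free_module (Suc n)" "comb (fs @ [f]) x = (\<lambda>_. 0)" by auto
    \<comment> \<open>The syzygy relation itself exhibits \<open>x n * f\<close> as a combination of
      \<open>fs\<close>, so \<open>x n\<close> lies in the colon ideal.\<close>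
    have "(\<lambda>i. x n * f i) \<in> gen fs"
    proof -
      define u where "u j = (if j < n then - x j else 0)" for j
      have "u \<in> free_module n"
        using x(1) by (auto simp: u_def free_module_def R_uminus)
      moreover have "comb fs u = comb fs (\<lambda>j. - x j)"
        by (rule comb_cong) (simp add: u_def n_def)
      then have "comb fs u = (\<lambda>i. x n * f i)"
        using x(2) by (auto simp: comb_uminus comb_snoc n_def fun_eq_iff add_eq_0_iff)
      ultimately show ?thesis
        unfolding gen_def n_def by force
    qed
    then have "x n \<in> ideal gs"
      using colon x(1) by (auto simp: free_module_def)
    then show "x \<in> gen (hs @ hs')"
      using gen_iff[OF _ x, of "length gs"] by (simp add: hs'_def)
  qed
  ultimately show ?case
    by (intro exI[of _ "hs @ hs'"]) (simp add: n_def)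
qed

section \<open>The residue field and the assembly of the resolution\<close>

definition unit_vector :: "'a \<Rightarrow> nat \<Rightarrow> 'a" where
  "unit_vector g = (\<lambda>i. if i = 0 then g else 0)"

lemma gen_unit_vectors: "gen (map unit_vector gs) = unit_vector ` ideal gs"
proof -
  have "comb (map unit_vector gs) v = unit_vector (\<Sum>j<length gs. v j * gs ! j)" for v
    by (auto simp: comb_def unit_vector_def fun_eq_iff)
  then show ?thesis
    by (auto simp: gen_def ideal_def)
qed

lemma mult_unit_vector: "(\<lambda>i. r * unit_vector g i) = unit_vector (r * g)"
  by (auto simp: unit_vector_def)

lemma unit_vector_in_image: "unit_vector g \<in> unit_vector ` I \<longleftrightarrow> g \<in> I"
proof -
  have "inj unit_vector"
    by (rule injI) (auto simp: unit_vector_def fun_eq_iff split: if_splits)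
  then show ?thesis by (simp add: inj_image_mem_iff)
qed

lemma filtered_unit_vectors:
  assumes "koszul_filtration F" and "gs \<in> F"
  shows "filtered F 1 (map unit_vector gs)"
proof -
  have gs: "set gs \<subseteq> A 1"
    and colon: "\<forall>l<length gs. \<exists>gs'\<in>F. \<forall>r\<in>R. r * gs ! l \<in> ideal (take l gs) \<longleftrightarrow> r \<in> ideal gs'"
    using assms by (auto simp: koszul_filtration_def)
  have "(\<lambda>i. r * (map unit_vector gs ! l) i) \<in> gen (take l (map unit_vector gs)) \<longleftrightarrow>
      r * gs ! l \<in> ideal (take l gs)" if "l < length gs" for l r
    using that by (simp add: mult_unit_vector take_map gen_unit_vectors unit_vector_in_image)
  then show ?thesis
    unfolding filtered_def using gs colon by (auto simp: unit_vector_def)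
qed

lemma ex1_residue:
  assumes "x \<in> R"
  shows "\<exists>!c. hcomp x 0 = scale c 1"
proof -
  have "hcomp x 0 \<in> span {1}"
    using hcomp_in[OF assms, of 0] by (simp add: A_0)
  then obtain c where "hcomp x 0 = scale c 1"
    by (auto simp: span_singleton)
  then show ?thesis by auto
qed

definition residue :: "'a \<Rightarrow> 'k" where
  "residue x = (THE c. hcomp x 0 = scale c 1)"

lemma hcomp_residue: "x \<in> R \<Longrightarrow> hcomp x 0 = scale (residue x) 1"
  unfolding residue_def by (rule theI') (rule ex1_residue)

lemma residue_iff: "x \<in> R \<Longrightarrow> residue x = c \<longleftrightarrow> hcomp x 0 = scale c 1"
  using ex1_residue[of x] hcomp_residue[of x] by blast

lemma residue_add: "x \<in> R \<Longrightarrow> y \<in> R \<Longrightarrow> residue (x + y) = residue x + residue y"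
  by (subst residue_iff)
    (simp_all add: R_add scale_left_distrib hcomp_residue[of x] hcomp_residue[of y])

lemma irrelevant_ideal_iff: "x \<in> irrelevant_ideal \<longleftrightarrow> x \<in> R \<and> residue x = 0"
  by (auto simp: irrelevant_ideal_eq residue_iff)

text \<open>Subtracting the scalar \<open>c\<close> from \<open>r\<close> leaves an element without
  degree 0 part, whose product with any \<open>x\<close> has no degree 0 part either.\<close>

lemma residue_mult:
  assumes "r \<in> R" and "r - scale c 1 \<in> irrelevant_ideal" and "x \<in> R"
  shows "residue (r * x) = c * residue x"
proof -
  define r' where "r' = r - scale c 1"
  have r': "r' \<in> R" "hcomp r' 0 = 0"
    using assms by (auto simp: r'_def irrelevant_ideal_eq)
  define S where "S = {n. hcomp r' n \<noteq> 0}"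
  have S: "n > 0" if "n \<in> S" for n
    using that r' by (cases n) (auto simp: S_def)
  have in_R: "hcomp r' n * x \<in> R" for n
    by (rule homogeneous_mult_R(1)[OF hcomp_in[OF r'(1)] assms(3)])
  have "r' * x = (\<Sum>n\<in>S. hcomp r' n * x)"
    using sum_hcomp[OF r'(1)] by (simp add: sum_distrib_right[symmetric] S_def)
  then have "hcomp (r' * x) 0 = (\<Sum>n\<in>S. hcomp (hcomp r' n * x) 0)"
    using in_R by (simp add: hcomp_sum)
  also have "\<dots> = 0"
    using homogeneous_mult_R(3)[OF hcomp_in[OF r'(1)] assms(3)] S by (simp add: sum.neutral)
  finally have "hcomp (r' * x) 0 = 0" .
  moreover have "r * x = r' * x + scale c x"
    by (simp add: r'_def left_diff_distrib scale_mult[symmetric])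
  ultimately have "hcomp (r * x) 0 = scale c (hcomp x 0)"
    using R_mult[OF r'(1) assms(3)] by (simp add: R_add R_scale assms(3))
  then show ?thesis
    by (subst residue_iff) (simp_all add: R_mult assms hcomp_residue[OF assms(3)])
qed

lemma graded_augmentation_residue: "graded_augmentation 1 (\<lambda>_. 0) (\<lambda>v. residue (v 0))"
  unfolding graded_augmentation_def
proof (intro conjI ballI allI impI)
  have "c \<in> (\<lambda>v. residue (v 0)) ` free_module 1" for c
  proof
    have "scale c 1 \<in> A 0"
      by (simp add: A_0 span_base span_scale)
    then have "hcomp (scale c 1) 0 = scale c 1" and "scale c 1 \<in> R"
      using hcomp_homogeneous[of "scale c 1" 0] A_subset_R[of 0] by auto
    then show "c = residue (unit_vector (scale c 1) 0)"
      by (simp add: unit_vector_def residue_iff eq_commute[of c])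
    show "unit_vector (scale c 1) \<in> free_module 1"
      using \<open>scale c 1 \<in> R\<close> by (simp add: unit_vector_def free_module_def)
  qed
  then show "(\<lambda>v. residue (v 0)) ` free_module 1 = UNIV" by blast
next
  fix u v assume "u \<in> free_module 1" "v \<in> free_module 1"
  then show "residue (u 0 + v 0) = residue (u 0) + residue (v 0)"
    by (simp add: free_module_def residue_add)
next
  fix r c v assume "r \<in> R" "r - scale c 1 \<in> irrelevant_ideal" "v \<in> free_module 1"
  then show "residue (r * v 0) = c * residue (v 0)"
    by (simp add: free_module_def residue_mult)
next
  fix n :: nat and v assume "0 < n" and "v \<in> free_component 1 (\<lambda>_. 0) n"
  then have "v 0 \<in> A n" by (simp add: free_component_def)
  then show "residue (v 0) = 0"
    using A_subset_R[of n] hcomp_homogeneous[of "v 0" n 0] \<open>0 < n\<close> by (auto simp: residue_iff)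
qed

lemma graded_hom_comb:
  assumes "filtered F b fs"
  shows "graded_hom (length fs) (\<lambda>_. Suc i) b (\<lambda>_. i) (comb fs)"
  unfolding graded_hom_def
proof (intro conjI ballI allI)
  show "comb fs ` free_module (length fs) \<subseteq> free_module b"
    using gen_free_module[of fs b] filtered_free_module[OF assms] by (simp add: gen_def)
  show "comb fs (\<lambda>j. u j + v j) = (\<lambda>j. comb fs u j + comb fs v j)" for u v
    by (rule comb_add)
  show "comb fs (\<lambda>j. r * v j) = (\<lambda>j. r * comb fs v j)" for r v
    by (rule comb_mult)
next
  fix n
  show "comb fs ` free_component (length fs) (\<lambda>_. Suc i) n \<subseteq> free_component b (\<lambda>_. i) n"
  proof (rule image_subsetI)
    fix v assume v: "v \<in> free_component (length fs) (\<lambda>_. Suc i) n"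
    have fs: "(fs ! j) k \<in> (if k < b then A 1 else {0})" if "j < length fs" for j k
      using assms that unfolding filtered_def by (meson nth_mem)
    have "v j * (fs ! j) k \<in> (if i \<le> n then A (n - i) else {0})" if "k < b" "j < length fs" for j k
    proof (cases "Suc i \<le> n")
      case True
      then have "n - Suc i + 1 = n - i" by simp
      moreover have "v j \<in> A (n - Suc i)"
        using v that True by (auto simp: free_component_def)
      moreover have "(fs ! j) k \<in> A 1"
        using fs[of j k] that by simp
      ultimately show ?thesis
        using A_mult[of "v j" "n - Suc i" "(fs ! j) k" 1] True by simp
    next
      \<comment> \<open>Here \<open>n \<le> i\<close>. For \<open>n = i\<close> the target component
        is built from \<open>A 0\<close>, but the coefficients already vanish, since the source
        starts in degree \<open>i + 1\<close>.\<close>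
      case False
      then have "v j = 0" using v that by (simp add: free_component_def)
      then show ?thesis by simp
    qed
    moreover have "subspace (if i \<le> n then A (n - i) else {0})"
      using subspace_A subspace_single_0 by simp
    ultimately have "comb fs v k \<in> (if i \<le> n then A (n - i) else {0})" if "k < b" for k
      unfolding comb_def using that by (intro subspace_sum) auto
    moreover have "comb fs v k = 0" if "b \<le> k" for k
      unfolding comb_def using fs[of _ k] that by (intro sum.neutral) auto
    ultimately show "comb fs v \<in> free_component b (\<lambda>_. i) n"
      by (simp add: free_component_def)
  qed
qed

theorem linear_resolution_of_koszul_filtration:
  assumes F: "koszul_filtration F" and "gs \<in> F" and gs: "ideal gs = irrelevant_ideal"
  shows "\<exists>b e d \<epsilon>. graded_free_resolution b e d \<epsilon> \<and> linear_degrees b e"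
proof -
  define step where "step fs = (SOME hs. filtered F (length fs) hs \<and>
    gen hs = {v \<in> free_module (length fs). comb fs v = (\<lambda>_. 0)})" for fs
  have step: "filtered F (length fs) (step fs) \<and>
      gen (step fs) = {v \<in> free_module (length fs). comb fs v = (\<lambda>_. 0)}"
    if "filtered F b fs" for b fs
    unfolding step_def by (rule someI_ex) (rule filtered_syzygies[OF F that])
  \<comment> \<open>\<open>fs i\<close> holds the columns of the \<open>i\<close>-th differential,
    whose source has rank \<open>length (fs i)\<close>; hence the shift in \<open>b\<close>, which
    starts with \<open>R\<close> itself in rank 1.\<close>
  define fs where "fs i = (step ^^ i) (map unit_vector gs)" for i
  define b where "b i = (case i of 0 \<Rightarrow> 1 | Suc i \<Rightarrow> length (fs i))" for i
  have fs_Suc: "fs (Suc i) = step (fs i)" for i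
    by (simp add: fs_def)
  have filt: "filtered F (b i) (fs i)" for i
  proof (induction i)
    case 0
    then show ?case
      using filtered_unit_vectors[OF F \<open>gs \<in> F\<close>] by (simp add: b_def fs_def)
  next
    case (Suc i)
    then show ?case
      using step by (simp add: b_def fs_Suc)
  qed
  have "{v \<in> free_module 1. residue (v 0) = 0} = gen (fs 0)"
  proof -
    have "{v \<in> free_module 1. residue (v 0) = 0} = unit_vector ` irrelevant_ideal"
    proof (intro equalityI subsetI)
      fix v assume v: "v \<in> {v \<in> free_module 1. residue (v 0) = 0}"
      then have "v = unit_vector (v 0)" and "v 0 \<in> irrelevant_ideal"
        by (auto simp: free_module_def unit_vector_def irrelevant_ideal_iff)
      then show "v \<in> unit_vector ` irrelevant_ideal" by blast
    qed (auto simp: free_module_def unit_vector_def irrelevant_ideal_iff)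
    then show ?thesis by (simp add: fs_def gen_unit_vectors gs)
  qed
  moreover have "graded_hom (b (Suc i)) (\<lambda>_. Suc i) (b i) (\<lambda>_. i) (comb (fs i))" for i
    using graded_hom_comb[OF filt] by (simp add: b_def)
  moreover have "{v \<in> free_module (b (Suc i)). comb (fs i) v = (\<lambda>_. 0)} =
      comb (fs (Suc i)) ` free_module (b (Suc (Suc i)))" for i
    using step[OF filt, of i] by (simp add: fs_Suc b_def gen_def)
  ultimately have "graded_free_resolution b (\<lambda>i _. i) (\<lambda>i. comb (fs i)) (\<lambda>v. residue (v 0))"
    using graded_augmentation_residue
    unfolding graded_free_resolution_def by (simp add: b_def gen_def)
  moreover have "linear_degrees b (\<lambda>i _. i)"
    by (simp add: linear_degrees_def)
  ultimately show ?thesis by blast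
qed

end

section \<open>Monomials\<close>

type_synonym 'p exponent = "('p xy_var \<Rightarrow>\<^sub>0 nat) \<times> nat"

definition mon :: "'p exponent \<Rightarrow> ('p, 'k::field) mpoly_xy poly" where
  "mon t = monom (Poly_Mapping.single (fst t) 1) (snd t)"

definition coef :: "('p, 'k::field) mpoly_xy poly \<Rightarrow> 'p exponent \<Rightarrow> 'k" where
  "coef f t = Poly_Mapping.lookup (coeff f (snd t)) (fst t)"

definition supp :: "('p, 'k::field) mpoly_xy poly \<Rightarrow> 'p exponent set" where
  "supp f = {t. coef f t \<noteq> 0}"

lemma coef_eqI: "(\<And>t. coef f t = coef g t) \<Longrightarrow> f = g"
  unfolding coef_def by (intro poly_eqI poly_mapping_eqI) (metis fst_conv snd_conv)

lemma coef_zero [simp]: "coef 0 t = 0"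
  by (simp add: coef_def)

lemma coef_add [simp]: "coef (f + g) t = coef f t + coef g t"
  by (simp add: coef_def lookup_add)

lemma coef_diff [simp]: "coef (f - g) t = coef f t - coef g t"
  by (simp add: coef_def lookup_minus)

lemma coef_sum: "coef (\<Sum>i\<in>S. f i) t = (\<Sum>i\<in>S. coef (f i) t)"
  by (induction S rule: infinite_finite_induct) auto

lemma coef_scale_K [simp]:
  fixes f :: "('p, 'k::field) mpoly_xy poly"
  shows "coef (scale_K c f) t = c * coef f t"
proof -
  have "Poly_Mapping.lookup (Poly_Mapping.single 0 c * g) m = c * Poly_Mapping.lookup g m"
    for g :: "('p, 'k) mpoly_xy" and m
    by (subst mult_map_scale_conv_mult[symmetric]) (simp add: Poly_Mapping.map.rep_eq when_def)
  then show ?thesis by (simp add: coef_def scale_K_def)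
qed

lemma coef_mon: "coef (mon s) t = (if s = t then 1 else 0)"
  by (auto simp: coef_def mon_def lookup_single when_def prod_eq_iff)

lemma mon_mult: "mon s * mon t = mon (s + t)"
  by (simp add: mon_def mult_monom mult_single)

lemma mon_zero [simp]: "mon 0 = 1"
  by (simp add: mon_def)

lemma finite_supp [simp]: "finite (supp f)"
proof -
  have "supp f \<subseteq> (\<Union>k\<le>degree f. (\<lambda>m. (m, k)) ` Poly_Mapping.keys (coeff f k))"
  proof
    fix t assume "t \<in> supp f"
    then have t: "Poly_Mapping.lookup (coeff f (snd t)) (fst t) \<noteq> 0"
      by (simp add: supp_def coef_def)
    then have "snd t \<le> degree f"
      by (intro le_degree) auto
    moreover have "fst t \<in> Poly_Mapping.keys (coeff f (snd t))"
      using t by (simp add: in_keys_iff)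
    ultimately show "t \<in> (\<Union>k\<le>degree f. (\<lambda>m. (m, k)) ` Poly_Mapping.keys (coeff f k))"
      by (intro UN_I[of "snd t"] image_eqI[of _ _ "fst t"]) auto
  qed
  then show ?thesis
    by (rule finite_subset) auto
qed

lemma expansion: "f = (\<Sum>t\<in>supp f. scale_K (coef f t) (mon t))"
  by (rule coef_eqI) (simp add: coef_sum coef_mon if_distrib cong: if_cong, simp add: supp_def)

interpretation scale_K: vector_space
  "scale_K :: 'k::field \<Rightarrow> ('p, 'k) mpoly_xy poly \<Rightarrow> ('p, 'k) mpoly_xy poly"
  by unfold_locales (auto intro!: coef_eqI simp: algebra_simps)

lemma scale_K_mult: "scale_K c (f * g) = scale_K c f * g"
  by (simp add: scale_K_def)

lemma scale_K_mult_right: "scale_K c (f * g) = f * scale_K c g"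
  by (simp add: scale_K_def)

lemma coef_mult:
  "coef (f * g) t = (\<Sum>s\<in>supp f. \<Sum>u\<in>supp g. if s + u = t then coef f s * coef g u else 0)"
proof -
  have "f * g = (\<Sum>s\<in>supp f. \<Sum>u\<in>supp g. scale_K (coef f s) (mon s) * scale_K (coef g u) (mon u))"
    by (subst expansion[of f], subst expansion[of g], simp only: sum_product)
  also have "\<dots> = (\<Sum>s\<in>supp f. \<Sum>u\<in>supp g. scale_K (coef f s * coef g u) (mon (s + u)))"
    by (simp add: scale_K_mult[symmetric] scale_K_mult_right[symmetric] mon_mult mult.commute)
  finally show ?thesis
    by (simp add: coef_sum coef_mon if_distrib cong: if_cong)
qed

lemma supp_mult:
  assumes "t \<in> supp (f * g)"
  obtains s u where "s \<in> supp f" "u \<in> supp g" "t = s + u"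
proof -
  have "\<exists>s\<in>supp f. \<exists>u\<in>supp g. s + u = t"
  proof (rule ccontr)
    assume "\<not> ?thesis"
    then have "coef (f * g) t = 0"
      unfolding coef_mult by (intro sum.neutral ballI) auto
    then show False using assms by (simp add: supp_def)
  qed
  then show ?thesis using that by blast
qed

lemma supp_mon: "supp (mon s) = {s}"
  by (auto simp: supp_def coef_mon)

lemma coef_mult_mon: "coef (f * mon s) (t + s) = coef f t"
proof -
  have "coef (f * mon s) (t + s) = (\<Sum>u\<in>supp f. if u = t then coef f u else 0)"
    unfolding coef_mult by (rule sum.cong) (auto simp: supp_mon coef_mon)
  then show ?thesis
    by simp (simp add: supp_def)
qed

lemma supp_mult_mon: "supp (f * mon s) = (\<lambda>t. t + s) ` supp f"
proof (intro equalityI subsetI)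
  fix t assume "t \<in> supp (f * mon s)"
  then show "t \<in> (\<lambda>t. t + s) ` supp f"
    by (rule supp_mult) (auto simp: supp_mon)
qed (auto simp: supp_def coef_mult_mon)

definition supported :: "'p exponent set \<Rightarrow> ('p, 'k::field) mpoly_xy poly set" where
  "supported S = {f. supp f \<subseteq> S}"

lemma mon_in_supported [simp]: "mon t \<in> supported S \<longleftrightarrow> t \<in> S"
  by (simp add: supported_def supp_mon)

lemma supportedI: "(\<And>t. coef f t \<noteq> 0 \<Longrightarrow> t \<in> S) \<Longrightarrow> f \<in> supported S"
  by (auto simp: supported_def supp_def)

lemma coef_supported: "f \<in> supported S \<Longrightarrow> t \<notin> S \<Longrightarrow> coef f t = 0"
  by (auto simp: supported_def supp_def)

lemma supported_zero [simp]: "0 \<in> supported S"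
  by (rule supportedI) simp

lemma supported_add: "f \<in> supported S \<Longrightarrow> g \<in> supported S \<Longrightarrow> f + g \<in> supported S"
  by (intro supportedI) (metis add_0 coef_add coef_supported)

lemma supported_scale: "f \<in> supported S \<Longrightarrow> scale_K c f \<in> supported S"
  by (intro supportedI) (metis coef_scale_K coef_supported mult_zero_right)

lemma supported_sum: "(\<And>i. i \<in> I \<Longrightarrow> f i \<in> supported S) \<Longrightarrow> (\<Sum>i\<in>I. f i) \<in> supported S"
  by (intro supportedI) (metis coef_sum coef_supported sum.neutral)

lemma supported_mult:
  assumes "f \<in> supported S" and "g \<in> supported T"
    and "\<And>s t. s \<in> S \<Longrightarrow> t \<in> T \<Longrightarrow> s + t \<in> U"
  shows "f * g \<in> supported U"
proof -
  have "t \<in> U" if "t \<in> supp (f * g)" for t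
    using that assms unfolding supported_def by (blast elim: supp_mult)
  then show ?thesis by (auto simp: supported_def)
qed

lemma supported_diff: "f \<in> supported S \<Longrightarrow> g \<in> supported S \<Longrightarrow> f - g \<in> supported S"
  by (intro supportedI) (metis coef_diff coef_supported diff_zero)

lemma supported_mono: "S \<subseteq> T \<Longrightarrow> supported S \<subseteq> supported T"
  by (auto simp: supported_def)

lemma span_mon:
  "scale_K.span (mon ` S :: ('p, 'k::field) mpoly_xy poly set) = supported S"
proof (intro equalityI subsetI)
  fix f :: "('p, 'k) mpoly_xy poly"
  assume "f \<in> scale_K.span (mon ` S)"
  then show "f \<in> supported S"
    by (induction rule: scale_K.span_induct_alt) (auto intro!: supported_add supported_scale)
next
  fix f :: "('p, 'k) mpoly_xy poly"
  assume "f \<in> supported S"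
  then have "scale_K (coef f t) (mon t) \<in> scale_K.span (mon ` S)" if "t \<in> supp f" for t
    using that by (intro scale_K.span_scale scale_K.span_base) (auto simp: supported_def)
  then show "f \<in> scale_K.span (mon ` S)"
    by (subst expansion) (rule scale_K.span_sum)
qed

section \<open>The semigroup of the Rees algebra\<close>

definition x_exp :: "'p exponent \<Rightarrow> 'p \<Rightarrow> nat" where
  "x_exp t p = Poly_Mapping.lookup (fst t) (X p)"

definition y_exp :: "'p exponent \<Rightarrow> 'p \<Rightarrow> nat" where
  "y_exp t p = Poly_Mapping.lookup (fst t) (Y p)"

lemma x_exp_add [simp]: "x_exp (s + t) p = x_exp s p + x_exp t p"
  by (simp add: x_exp_def lookup_add)

lemma y_exp_add [simp]: "y_exp (s + t) p = y_exp s p + y_exp t p"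
  by (simp add: y_exp_def lookup_add)

lemma x_exp_zero [simp]: "x_exp 0 p = 0"
  by (simp add: x_exp_def)

lemma y_exp_zero [simp]: "y_exp 0 p = 0"
  by (simp add: y_exp_def)

lemma exponent_eqI:
  assumes "\<And>p. x_exp s p = x_exp t p" and "\<And>p. y_exp s p = y_exp t p" and "snd s = snd t"
  shows "s = t"
proof -
  have "Poly_Mapping.lookup (fst s) v = Poly_Mapping.lookup (fst t) v" for v
    using assms(1,2) by (cases v) (auto simp: x_exp_def y_exp_def)
  then show ?thesis
    using assms(3) by (simp add: prod_eq_iff poly_mapping_eqI)
qed

text \<open>Truncated subtraction: the difference is meaningful only if \<open>s\<close> divides \<open>t\<close>.\<close>

lemma
  shows x_exp_diff [simp]: "x_exp (t - s) p = x_exp t p - x_exp s p"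
    and y_exp_diff [simp]: "y_exp (t - s) p = y_exp t p - y_exp s p"
  by (simp_all add: x_exp_def y_exp_def minus_poly_mapping.rep_eq)

locale finite_poset =
  fixes P :: "'p set" and r :: "'p rel"
  assumes finite_P: "finite P" and partial_order: "partial_order_on P r"
begin

lemma r_in_P: "(p, q) \<in> r \<Longrightarrow> p \<in> P \<and> q \<in> P"
  using partial_order by (auto simp: partial_order_on_def preorder_on_def)

lemma r_refl: "p \<in> P \<Longrightarrow> (p, p) \<in> r"
  using partial_order by (auto simp: partial_order_on_def preorder_on_def refl_on_def)

lemma r_trans: "(p, q) \<in> r \<Longrightarrow> (q, s) \<in> r \<Longrightarrow> (p, s) \<in> r"
  using partial_order unfolding partial_order_on_def preorder_on_def by (blast dest: transD)

lemma r_antisym: "(p, q) \<in> r \<Longrightarrow> (q, p) \<in> r \<Longrightarrow> p = q"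
  using partial_order unfolding partial_order_on_def by (blast dest: antisymD)

text \<open>An element with the smallest principal down-set is minimal, since passing to a strictly
  smaller element shrinks the down-set.\<close>

lemma minimal_element:
  assumes "S \<subseteq> P" and "S \<noteq> {}"
  obtains p where "p \<in> S" and "\<And>q. q \<in> S \<Longrightarrow> (q, p) \<in> r \<Longrightarrow> q = p"
proof -
  define down where "down p = {q \<in> P. (q, p) \<in> r}" for p
  obtain p where p: "p \<in> S" "\<And>q. q \<in> S \<Longrightarrow> card (down p) \<le> card (down q)"
    using assms(2) ex_has_least_nat[of "\<lambda>p. p \<in> S" _ "\<lambda>p. card (down p)"] by blast
  have "q = p" if "q \<in> S" "(q, p) \<in> r" for q
  proof (rule ccontr)
    assume "q \<noteq> p"
    have "p \<in> down p" and "p \<notin> down q"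
      using that \<open>q \<noteq> p\<close> r_in_P r_refl r_antisym by (auto simp: down_def)
    moreover have "down q \<subseteq> down p"
      using that r_trans by (auto simp: down_def)
    ultimately have "card (down q) < card (down p)"
      using finite_P by (intro psubset_card_mono) (auto simp: down_def)
    then show False using p(2)[OF that(1)] by simp
  qed
  then show ?thesis using p(1) that by blast
qed

abbreviation L :: "'p set set" where
  "L \<equiv> poset_ideals P r"

lemma idealD: "I \<in> L \<Longrightarrow> q \<in> I \<Longrightarrow> (p, q) \<in> r \<Longrightarrow> p \<in> I"
  using r_in_P by (auto simp: poset_ideals_def)

lemma ideal_subset: "I \<in> L \<Longrightarrow> I \<subseteq> P"
  by (auto simp: poset_ideals_def)

lemma finite_L: "finite L"
  using finite_P by (intro finite_subset[of L "Pow P"]) (auto simp: poset_ideals_def)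

definition exponents :: "'p exponent set" where
  "exponents = {t. (\<forall>p. p \<notin> P \<longrightarrow> x_exp t p = 0 \<and> y_exp t p = 0) \<and>
     (\<forall>(p, q)\<in>r. snd t \<le> x_exp t p + y_exp t q)}"

lemma exponents_le: "t \<in> exponents \<Longrightarrow> (p, q) \<in> r \<Longrightarrow> snd t \<le> x_exp t p + y_exp t q"
  by (auto simp: exponents_def)

lemma zero_in_exponents [simp]: "0 \<in> exponents"
  by (simp add: exponents_def)

lemma add_in_exponents [simp]: "s \<in> exponents \<Longrightarrow> t \<in> exponents \<Longrightarrow> s + t \<in> exponents"
  by (fastforce simp: exponents_def)

definition gx :: "'p \<Rightarrow> 'p exponent" where
  "gx p = (Poly_Mapping.single (X p) 1, 0)"

definition gy :: "'p \<Rightarrow> 'p exponent" where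
  "gy p = (Poly_Mapping.single (Y p) 1, 0)"

definition gu :: "'p set \<Rightarrow> 'p exponent" where
  "gu I = ((\<Sum>p\<in>I. Poly_Mapping.single (X p) 1) + (\<Sum>p\<in>P - I. Poly_Mapping.single (Y p) 1), 1)"

lemma gx_simps [simp]:
  "x_exp (gx p) q = (if q = p then 1 else 0)" "y_exp (gx p) q = 0" "snd (gx p) = 0"
  by (auto simp: gx_def x_exp_def y_exp_def lookup_single when_def)

lemma gy_simps [simp]:
  "x_exp (gy p) q = 0" "y_exp (gy p) q = (if q = p then 1 else 0)" "snd (gy p) = 0"
  by (auto simp: gy_def x_exp_def y_exp_def lookup_single when_def)

lemma gu_simps [simp]:
  assumes "I \<in> L"
  shows "x_exp (gu I) p = (if p \<in> I then 1 else 0)"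
    and "y_exp (gu I) p = (if p \<in> P - I then 1 else 0)"
    and "snd (gu I) = 1"
proof -
  have "finite I" "finite (P - I)"
    using finite_P ideal_subset[OF assms] by (auto intro: finite_subset)
  then show "x_exp (gu I) p = (if p \<in> I then 1 else 0)"
    and "y_exp (gu I) p = (if p \<in> P - I then 1 else 0)" and "snd (gu I) = 1"
    by (simp_all add: gu_def x_exp_def y_exp_def lookup_add lookup_sum lookup_single when_def)
qed

text \<open>
  Each \<open>u\<^sub>I\<close> lies in the semigroup because an ideal containing \<open>q\<close> contains each \<open>p \<le> q\<close>.
\<close>

lemma generators_in_exponents [simp]:
  "p \<in> P \<Longrightarrow> gx p \<in> exponents" "p \<in> P \<Longrightarrow> gy p \<in> exponents" "I \<in> L \<Longrightarrow> gu I \<in> exponents"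
  using r_in_P by (auto simp: exponents_def dest: idealD ideal_subset)

section \<open>Divisibility in the semigroup\<close>

definition multiples :: "'p exponent \<Rightarrow> 'p exponent set" where
  "multiples g = (+) g ` exponents"

text \<open>The semigroup consists of all points satisfying its inequalities, so divisibility only
  asks that the difference satisfy them. Terms are moved across so that no truncated subtraction
  occurs.\<close>

lemma multiples_iff:
  assumes "t \<in> exponents" and "g \<in> exponents"
  shows "t \<in> multiples g \<longleftrightarrow> (\<forall>p\<in>P. x_exp g p \<le> x_exp t p \<and> y_exp g p \<le> y_exp t p) \<and>
    snd g \<le> snd t \<and>
    (\<forall>(p, q)\<in>r. snd t + x_exp g p + y_exp g q \<le> x_exp t p + y_exp t q + snd g)"
proof
  assume "t \<in> multiples g"
  then obtain u where "u \<in> exponents" "t = g + u" by (auto simp: multiples_def)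
  then show "(\<forall>p\<in>P. x_exp g p \<le> x_exp t p \<and> y_exp g p \<le> y_exp t p) \<and> snd g \<le> snd t \<and>
    (\<forall>(p, q)\<in>r. snd t + x_exp g p + y_exp g q \<le> x_exp t p + y_exp t q + snd g)"
    by (auto dest: exponents_le)
next
  assume *: "(\<forall>p\<in>P. x_exp g p \<le> x_exp t p \<and> y_exp g p \<le> y_exp t p) \<and> snd g \<le> snd t \<and>
    (\<forall>(p, q)\<in>r. snd t + x_exp g p + y_exp g q \<le> x_exp t p + y_exp t q + snd g)"
  have le: "x_exp g p \<le> x_exp t p \<and> y_exp g p \<le> y_exp t p" for p
    using * assms by (cases "p \<in> P") (auto simp: exponents_def)
  have "t - g \<in> exponents"
    unfolding exponents_def
  proof (intro CollectI conjI allI impI ballI)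
    fix p assume "p \<notin> P"
    then show "x_exp (t - g) p = 0" "y_exp (t - g) p = 0"
      using assms by (auto simp: exponents_def)
  next
    fix pq assume "pq \<in> r"
    obtain p q where pq: "pq = (p, q)" by (cases pq)
    then have "snd t + x_exp g p + y_exp g q \<le> x_exp t p + y_exp t q + snd g"
      using * \<open>pq \<in> r\<close> by auto
    then have "snd (t - g) \<le> x_exp (t - g) p + y_exp (t - g) q"
      using le[of p] le[of q] * by simp
    then show "case pq of (p, q) \<Rightarrow> snd (t - g) \<le> x_exp (t - g) p + y_exp (t - g) q"
      by (simp add: pq)
  qed
  moreover have "t = g + (t - g)"
    by (rule exponent_eqI) (use le * in auto)
  ultimately show "t \<in> multiples g"
    unfolding multiples_def by blast
qed

text \<open>Removing one \<open>x\<^sub>p\<close> touches only the inequalities at pairs with first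
  entry \<open>p\<close>; none of these may be tight for \<open>t\<close>.\<close>

lemma multiples_gx:
  assumes "t \<in> exponents" and "p \<in> P"
  shows "t \<in> multiples (gx p) \<longleftrightarrow>
    1 \<le> x_exp t p \<and> (\<forall>q. (p, q) \<in> r \<longrightarrow> snd t + 1 \<le> x_exp t p + y_exp t q)"
  using assms exponents_le[OF assms(1)] r_in_P by (subst multiples_iff) auto

lemma multiples_gy:
  assumes "t \<in> exponents" and "q \<in> P"
  shows "t \<in> multiples (gy q) \<longleftrightarrow>
    1 \<le> y_exp t q \<and> (\<forall>p. (p, q) \<in> r \<longrightarrow> snd t + 1 \<le> x_exp t p + y_exp t q)"
  using assms exponents_le[OF assms(1)] r_in_P by (subst multiples_iff) auto

text \<open>The ideal \<open>I\<close> of the overview: asking for positive x-exponents on the whole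
  principal down-set cuts the x-support down to its largest poset ideal.\<close>

definition base :: "'p exponent \<Rightarrow> 'p set" where
  "base t = {p \<in> P. \<forall>q. (q, p) \<in> r \<longrightarrow> 1 \<le> x_exp t q}"

lemma base_in_L: "base t \<in> L"
  using r_trans by (auto simp: base_def poset_ideals_def)

lemma base_greatest: "I \<in> L \<Longrightarrow> (\<And>p. p \<in> I \<Longrightarrow> 1 \<le> x_exp t p) \<Longrightarrow> I \<subseteq> base t"
  by (auto simp: base_def dest: idealD ideal_subset)

lemma x_exp_base: "p \<in> base t \<Longrightarrow> 1 \<le> x_exp t p"
  using r_refl by (auto simp: base_def)

text \<open>An element \<open>q\<close> outside \<open>base t\<close> lies above some
  \<open>s\<close> with x-exponent 0, and the inequality at \<open>(s, q)\<close> forces its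
  y-exponent to be at least \<open>snd t\<close>. This pays for the critical pairs with
  \<open>p \<in> base t\<close> and \<open>q \<notin> base t\<close>, where both exponents drop by 1
  while \<open>snd t\<close> drops only once.\<close>

lemma base_multiple:
  assumes t: "t \<in> exponents" and "1 \<le> snd t"
  shows "t \<in> multiples (gu (base t))"
proof -
  have y: "snd t \<le> y_exp t q" if q: "q \<in> P - base t" for q
  proof -
    obtain s where "(s, q) \<in> r" "x_exp t s = 0"
      using q by (auto simp: base_def)
    then show ?thesis using exponents_le[OF t] by fastforce
  qed
  have "snd t + x_exp (gu (base t)) p + y_exp (gu (base t)) q \<le> x_exp t p + y_exp t q + 1"
    if "(p, q) \<in> r" for p q
    using exponents_le[OF t that] y[of q] x_exp_base[of p t] idealD[OF base_in_L _ that] assms(2)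
      base_in_L[of t]
    by auto
  then show ?thesis
    using x_exp_base y assms base_in_L[of t] by (subst multiples_iff) fastforce+
qed

lemma subset_base: "t \<in> multiples (gu I) \<Longrightarrow> I \<in> L \<Longrightarrow> I \<subseteq> base t \<and> 1 \<le> snd t"
  by (auto simp: multiples_def dest: ideal_subset intro!: base_greatest[THEN subsetD])

section \<open>Monomial ideals and their colon ideals\<close>

definition up_closed :: "'p set set \<Rightarrow> bool" where
  "up_closed Q \<longleftrightarrow> Q \<subseteq> L \<and> (\<forall>I\<in>Q. \<forall>J\<in>L. I \<subseteq> J \<longrightarrow> J \<in> Q)"

definition monomial_ideal :: "'p exponent set \<Rightarrow> 'p exponent set" where
  "monomial_ideal S = (\<Union>g\<in>S. multiples g)"

lemma monomial_ideal_Un: "monomial_ideal (S \<union> T) = monomial_ideal S \<union> monomial_ideal T"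
  by (auto simp: monomial_ideal_def)

text \<open>If some \<open>u\<^sub>I t\<close> with \<open>I \<in> Q\<close> divides, then
  \<open>I\<close> is contained in the base, so up-closure moves the test from \<open>I\<close> to
  the base, which always yields a divisor in positive \<open>t\<close>-degree.\<close>

lemma monomial_ideal_gu:
  assumes "up_closed Q" and "t \<in> exponents"
  shows "t \<in> monomial_ideal (gu ` Q) \<longleftrightarrow> 1 \<le> snd t \<and> base t \<in> Q"
  using assms base_multiple[of t] base_in_L[of t] subset_base[of t]
  unfolding up_closed_def monomial_ideal_def by fastforce

text \<open>
  Since \<open>base t\<close> records which monomials \<open>u\<^sub>I\<close> divide \<open>t\<close>, the colon ideals below are found by
  comparing \<open>base (t + g)\<close> with \<open>base t\<close>.
\<close>

definition min_outside :: "'p set \<Rightarrow> 'p set" where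
  "min_outside I = {p \<in> P - I. \<forall>q. (q, p) \<in> r \<longrightarrow> q \<noteq> p \<longrightarrow> q \<in> I}"

lemma up_closed_not_subset: "up_closed {J \<in> L. \<not> J \<subseteq> I}"
  by (auto simp: up_closed_def)

text \<open>The base of \<open>t + gu I\<close> contains \<open>I\<close>, so the product lies in
  the ideal unless this base is exactly \<open>I\<close>; it grows as soon as a minimal element
  \<open>p\<close> outside \<open>I\<close> occurs in \<open>t\<close>. The right-hand ideal
  expresses this occurrence: if \<open>x\<^sub>p\<close> fails to divide \<open>t\<close>, then some
  \<open>u\<^sub>J t\<close> with \<open>p \<in> J\<close> does.\<close>

lemma colon_gu:
  assumes Q: "up_closed Q" and I: "I \<in> L" "I \<notin> Q" and above: "\<And>J. J \<in> L \<Longrightarrow> I \<subset> J \<Longrightarrow> J \<in> Q"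
    and t: "t \<in> exponents"
  shows "t + gu I \<in> monomial_ideal (gu ` Q) \<longleftrightarrow>
    t \<in> monomial_ideal (gu ` {J \<in> L. \<not> J \<subseteq> I} \<union> gx ` min_outside I)"
proof -
  have sub: "I \<subseteq> base (t + gu I)"
    using I(1) by (intro base_greatest) auto
  have "t + gu I \<in> monomial_ideal (gu ` Q) \<longleftrightarrow> base (t + gu I) \<in> Q"
    using t I by (simp add: monomial_ideal_gu[OF Q])
  also have "\<dots> \<longleftrightarrow> base (t + gu I) \<noteq> I"
    using sub above[OF base_in_L, of "t + gu I"] I(2) by (auto simp: psubset_eq)
  also have "\<dots> \<longleftrightarrow> (\<exists>p\<in>min_outside I. 1 \<le> x_exp t p)"
  proof
    assume "base (t + gu I) \<noteq> I"
    then obtain p where p: "p \<in> base (t + gu I) - I"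
      and min: "\<And>q. q \<in> base (t + gu I) - I \<Longrightarrow> (q, p) \<in> r \<Longrightarrow> q = p"
      using sub minimal_element[of "base (t + gu I) - I"] ideal_subset[OF base_in_L] by blast
    have "p \<in> min_outside I"
      using p min idealD[OF base_in_L] ideal_subset[OF base_in_L]
      unfolding min_outside_def by blast
    moreover have "1 \<le> x_exp t p"
      using x_exp_base[of p "t + gu I"] p I by simp
    ultimately show "\<exists>p\<in>min_outside I. 1 \<le> x_exp t p" by blast
  next
    assume "\<exists>p\<in>min_outside I. 1 \<le> x_exp t p"
    then obtain p where p: "p \<in> min_outside I" "1 \<le> x_exp t p" by blast
    then have "p \<in> base (t + gu I)"
      using I unfolding base_def min_outside_def by fastforce
    then show "base (t + gu I) \<noteq> I"
      using p by (auto simp: min_outside_def)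
  qed
  also have "\<dots> \<longleftrightarrow> t \<in> monomial_ideal (gu ` {J \<in> L. \<not> J \<subseteq> I} \<union> gx ` min_outside I)"
  proof
    assume "\<exists>p\<in>min_outside I. 1 \<le> x_exp t p"
    then obtain p where p: "p \<in> min_outside I" "1 \<le> x_exp t p" by blast
    have "p \<in> P" "p \<notin> I" using p by (auto simp: min_outside_def)
    show "t \<in> monomial_ideal (gu ` {J \<in> L. \<not> J \<subseteq> I} \<union> gx ` min_outside I)"
    proof (cases "t \<in> multiples (gx p)")
      case True
      then show ?thesis using p by (auto simp: monomial_ideal_def)
    next
      case False
      \<comment> \<open>Failure of divisibility makes the inequality at some \<open>(p, q)\<close>
        tight. Comparison with the inequality at \<open>(s, q)\<close>, for \<open>s\<close> below
        \<open>p\<close>, shows that the exponent of \<open>x\<^sub>s\<close> is at least that of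
        \<open>x\<^sub>p\<close>.\<close>
      then obtain q where q: "(p, q) \<in> r" "x_exp t p + y_exp t q = snd t"
        using p exponents_le[OF t] by (fastforce simp: multiples_gx[OF t \<open>p \<in> P\<close>])
      have "1 \<le> x_exp t s" if "(s, p) \<in> r" for s
        using exponents_le[OF t r_trans[OF that q(1)]] p q(2) by simp
      then have "p \<in> base t"
        using \<open>p \<in> P\<close> by (simp add: base_def)
      then have "base t \<in> {J \<in> L. \<not> J \<subseteq> I}"
        using base_in_L \<open>p \<notin> I\<close> by blast
      then show ?thesis
        using q p by (simp add: monomial_ideal_Un monomial_ideal_gu[OF up_closed_not_subset t])
    qed
  next
    assume "t \<in> monomial_ideal (gu ` {J \<in> L. \<not> J \<subseteq> I} \<union> gx ` min_outside I)"
    then consider "base t \<in> {J \<in> L. \<not> J \<subseteq> I}" | p where "p \<in> min_outside I" "t \<in> multiples (gx p)"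
      by (auto simp: monomial_ideal_Un monomial_ideal_gu[OF up_closed_not_subset t])
        (auto simp: monomial_ideal_def)
    then show "\<exists>p\<in>min_outside I. 1 \<le> x_exp t p"
    proof cases
      case 1
      then obtain p where p: "p \<in> base t - I" and min: "\<And>q. q \<in> base t - I \<Longrightarrow> (q, p) \<in> r \<Longrightarrow> q = p"
        using minimal_element[of "base t - I"] ideal_subset[OF base_in_L] by blast
      have "p \<in> min_outside I"
        using p min idealD[OF base_in_L] ideal_subset[OF base_in_L]
        unfolding min_outside_def by blast
      then show ?thesis using x_exp_base p by blast
    next
      case 2
      then show ?thesis using t by (auto simp: min_outside_def multiples_gx)
    qed
  qed
  finally show ?thesis .
qed

text \<open>For \<open>p \<in> P\<close>, the added ideals are the possible values of
  \<open>base t\<close> for which multiplication by \<open>x\<^sub>p\<close> gives a monomial with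
  \<open>p\<close> in its base.\<close>

definition adjoin_below :: "'p \<Rightarrow> 'p set set \<Rightarrow> 'p set set" where
  "adjoin_below p Q = Q \<union> {J \<in> L. \<forall>q. (q, p) \<in> r \<longrightarrow> q \<noteq> p \<longrightarrow> q \<in> J}"

lemma up_closed_adjoin_below: "up_closed Q \<Longrightarrow> up_closed (adjoin_below p Q)"
  by (fastforce simp: up_closed_def adjoin_below_def)

text \<open>Multiplication by \<open>x\<^sub>p\<close> enlarges the base only if \<open>p\<close>
  itself enters, and then the new base lies in \<open>Q\<close>, which contains all ideals through
  \<open>p\<close>. Divisibility by another \<open>x\<^sub>q\<close> does not see the exponent of
  \<open>x\<^sub>p\<close>.\<close>

lemma colon_gx:
  assumes Q: "up_closed Q" "{J \<in> L. p \<in> J} \<subseteq> Q" and p: "p \<in> P" "p \<notin> A" "A \<subseteq> P"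
    and t: "t \<in> exponents"
  shows "t + gx p \<in> monomial_ideal (gu ` Q \<union> gx ` A) \<longleftrightarrow>
    t \<in> monomial_ideal (gu ` adjoin_below p Q \<union> gx ` A)"
proof -
  have tp: "t + gx p \<in> exponents" using t p by simp
  have sub: "base t \<subseteq> base (t + gx p)"
    using base_in_L x_exp_base by (intro base_greatest) (auto intro: trans_le_add1)
  have "base (t + gx p) \<in> Q \<longleftrightarrow> base t \<in> adjoin_below p Q"
  proof
    assume *: "base (t + gx p) \<in> Q"
    show "base t \<in> adjoin_below p Q"
    proof (cases "base (t + gx p) = base t")
      case True
      then show ?thesis using * by (simp add: adjoin_below_def)
    next
      case False
      then obtain q where "q \<in> base (t + gx p)" "q \<notin> base t" using sub by blast
      then have "(p, q) \<in> r"
        by (auto simp: base_def split: if_splits)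
      then have p_base: "p \<in> base (t + gx p)"
        using \<open>q \<in> base (t + gx p)\<close> idealD[OF base_in_L] by blast
      have "q' \<in> base t" if q': "(q', p) \<in> r" "q' \<noteq> p" for q'
      proof -
        have "1 \<le> x_exp t s" if "(s, q') \<in> r" for s
        proof -
          have "(s, p) \<in> r" "s \<noteq> p"
            using that q' r_trans r_antisym by blast+
          then have "1 \<le> x_exp (t + gx p) s"
            using p_base unfolding base_def by blast
          then show ?thesis using \<open>s \<noteq> p\<close> by simp
        qed
        then show ?thesis using q' r_in_P by (auto simp: base_def)
      qed
      then show ?thesis using base_in_L by (auto simp: adjoin_below_def)
    qed
  next
    assume "base t \<in> adjoin_below p Q"
    then consider "base t \<in> Q" | "\<forall>q. (q, p) \<in> r \<longrightarrow> q \<noteq> p \<longrightarrow> q \<in> base t"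
      by (auto simp: adjoin_below_def)
    then show "base (t + gx p) \<in> Q"
    proof cases
      case 1
      then show ?thesis using Q sub base_in_L unfolding up_closed_def by blast
    next
      case 2
      then have "p \<in> base (t + gx p)"
        using p(1) x_exp_base[of _ t] by (auto simp: base_def)
      then show ?thesis using Q base_in_L by blast
    qed
  qed
  moreover have "t + gx p \<in> multiples (gx q) \<longleftrightarrow> t \<in> multiples (gx q)" if "q \<in> A" for q
    using that p t tp by (auto simp: multiples_gx subset_iff)
  ultimately show ?thesis
    using Q t tp
    by (simp add: monomial_ideal_Un monomial_ideal_gu up_closed_adjoin_below)
      (simp add: monomial_ideal_def)
qed

text \<open>In positive \<open>t\<close>-degree both sides hold, since all
  \<open>u\<^sub>I t\<close> are present; in \<open>t\<close>-degree 0 divisibility by a variable is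
  decided by its own exponent. So the colon ideal is the ideal itself.\<close>

lemma colon_gy:
  assumes q: "q \<in> P" "q \<notin> B" "B \<subseteq> P" and "A \<subseteq> P" and t: "t \<in> exponents"
  shows "t + gy q \<in> monomial_ideal (gu ` L \<union> gx ` A \<union> gy ` B) \<longleftrightarrow>
    t \<in> monomial_ideal (gu ` L \<union> gx ` A \<union> gy ` B)"
proof -
  have tq: "t + gy q \<in> exponents" using t q by simp
  have L: "up_closed L" by (auto simp: up_closed_def)
  have u: "s \<in> monomial_ideal (gu ` L) \<longleftrightarrow> 1 \<le> snd s" if "s \<in> exponents" for s
    using that base_in_L by (simp add: monomial_ideal_gu[OF L])
  show ?thesis
  proof (cases "1 \<le> snd t")
    case True
    then show ?thesis using u t tq by (simp add: monomial_ideal_Un)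
  next
    case False
    then have k: "snd t = 0" by simp
    have "t + gy q \<in> multiples (gx p) \<longleftrightarrow> t \<in> multiples (gx p)" if "p \<in> A" for p
      using that assms tq k by (auto simp: multiples_gx subset_iff)
    moreover have "t + gy q \<in> multiples (gy p) \<longleftrightarrow> t \<in> multiples (gy p)" if "p \<in> B" for p
      using that assms tq k by (auto simp: multiples_gy subset_iff)
    ultimately show ?thesis
      using u t tq k by (simp add: monomial_ideal_Un) (simp add: monomial_ideal_def)
  qed
qed

end

section \<open>The grading of the Rees algebra\<close>

lemma products_Suc: "products G (Suc n) = {g * h | g h. g \<in> G \<and> h \<in> products G n}"
proof (intro equalityI subsetI)
  fix x assume "x \<in> products G (Suc n)"
  then obtain gs where "x = prod_list gs" "length gs = Suc n" "set gs \<subseteq> G"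
    by (auto simp: products_def)
  then show "x \<in> {g * h | g h. g \<in> G \<and> h \<in> products G n}"
    by (cases gs) (auto simp: products_def)
next
  fix x assume "x \<in> {g * h | g h. g \<in> G \<and> h \<in> products G n}"
  then obtain g gs where "x = prod_list (g # gs)" "length gs = n" "set (g # gs) \<subseteq> G"
    by (auto simp: products_def)
  then show "x \<in> products G (Suc n)"
    unfolding products_def by (intro CollectI exI[of _ "g # gs"]) auto
qed

lemma products_0: "products G 0 = {1}"
  by (simp add: products_def)

lemma products_1: "products G 1 = G"
  by (auto simp: products_Suc products_0)

lemma products_mono: "G \<subseteq> H \<Longrightarrow> products G n \<subseteq> products H n"
  by (auto simp: products_def)

lemma prod_single:
  "(\<Prod>p\<in>S. Poly_Mapping.single (e p) 1) = Poly_Mapping.single (\<Sum>p\<in>S. e p) (1::'k::comm_semiring_1)"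
  by (induction S rule: infinite_finite_induct) (auto simp: mult_single)

context finite_poset
begin

definition generators :: "'p exponent set" where
  "generators = gx ` P \<union> gy ` P \<union> gu ` L"

lemma rees_generators_eq:
  "(rees_generators P r :: ('p, 'k::field) mpoly_xy poly set) = mon ` generators"
proof -
  have "[:var (X p) :: ('p, 'k) mpoly_xy:] = mon (gx p)"
    and "[:var (Y p) :: ('p, 'k) mpoly_xy:] = mon (gy p)" for p
    by (simp_all add: mon_def gx_def gy_def var_def monom_0)
  moreover have "monom (u_monomial P I :: ('p, 'k) mpoly_xy) 1 = mon (gu I)" for I
    by (simp add: mon_def gu_def u_monomial_def var_def prod_single mult_single)
  ultimately show ?thesis
    by (simp add: rees_generators_def generators_def image_Un image_image)
qed

lemma finite_generators: "finite generators"
  using finite_P finite_L by (simp add: generators_def)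

lemma generators_subset: "generators \<subseteq> exponents"
  by (auto simp: generators_def)

text \<open>In \<open>t\<close>-degree 0 the inequalities are void and any variable that occurs
  divides; otherwise \<open>base_multiple\<close> supplies some \<open>u\<^sub>I t\<close>.
  Splitting off such divisors repeatedly shows that \<open>generators\<close> generates the
  semigroup.\<close>

lemma generator_divides:
  assumes t: "t \<in> exponents" and "t \<noteq> 0"
  obtains g u where "g \<in> generators" and "u \<in> exponents" and "t = g + u"
proof -
  have "\<exists>g\<in>generators. t \<in> multiples g"
  proof (cases "1 \<le> snd t")
    case True
    then show ?thesis
      using base_multiple[OF t] base_in_L[of t] unfolding generators_def by blast
  next
    case False
    then have k: "snd t = 0" by simp
    obtain p where "x_exp t p \<noteq> 0 \<or> y_exp t p \<noteq> 0"
      using exponent_eqI[of t 0] \<open>t \<noteq> 0\<close> k by fastforce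
    moreover from this have "p \<in> P"
      using t by (auto simp: exponents_def)
    ultimately have "t \<in> multiples (gx p) \<or> t \<in> multiples (gy p)"
      using k by (auto simp: multiples_gx[OF t] multiples_gy[OF t])
    then show ?thesis
      using \<open>p \<in> P\<close> by (auto simp: generators_def)
  qed
  then show ?thesis
    using that by (auto simp: multiples_def)
qed

text \<open>The degree for which \<open>x\<^sub>p\<close>, \<open>y\<^sub>p\<close> and \<open>u\<^sub>I t\<close> all have degree \<open>1\<close>.\<close>

definition edeg :: "'p exponent \<Rightarrow> nat" where
  "edeg t = snd t + (\<Sum>p\<in>P. x_exp t p + y_exp t p - snd t)"

lemma edeg_zero: "edeg 0 = 0"
  by (simp add: edeg_def)

text \<open>On \<open>exponents\<close> the truncated subtraction in \<open>edeg\<close> is exact,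
  by the inequality at \<open>(p, p)\<close>.\<close>

lemma edeg_add:
  assumes "s \<in> exponents" and "t \<in> exponents"
  shows "edeg (s + t) = edeg s + edeg t"
proof -
  have "(x_exp s p + y_exp s p - snd s) + (x_exp t p + y_exp t p - snd t) =
      x_exp (s + t) p + y_exp (s + t) p - snd (s + t)" if "p \<in> P" for p
    using exponents_le[OF assms(1) r_refl[OF that]] exponents_le[OF assms(2) r_refl[OF that]]
    by simp
  then have "(\<Sum>p\<in>P. x_exp (s + t) p + y_exp (s + t) p - snd (s + t)) =
      (\<Sum>p\<in>P. (x_exp s p + y_exp s p - snd s) + (x_exp t p + y_exp t p - snd t))"
    by (intro sum.cong) auto
  then show ?thesis
    by (simp add: edeg_def sum.distrib)
qed

lemma edeg_generator: "g \<in> generators \<Longrightarrow> edeg g = 1"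
proof -
  have "(\<Sum>p\<in>P. (if p \<in> I then 1 else 0) + (if p \<in> P - I then 1 else 0) - Suc 0) = 0" for I
    by (rule sum.neutral) auto
  then show "g \<in> generators \<Longrightarrow> edeg g = 1"
    using finite_P by (auto simp: generators_def edeg_def)
qed

definition component :: "nat \<Rightarrow> 'p exponent set" where
  "component n = {t \<in> exponents. edeg t = n}"

lemma component_0: "component 0 = {0}"
proof -
  have "t = 0" if t: "t \<in> exponents" "edeg t = 0" for t
  proof (rule ccontr)
    assume "t \<noteq> 0"
    then obtain g u where "g \<in> generators" "u \<in> exponents" "t = g + u"
      using generator_divides t(1) by blast
    then show False
      using t(2) edeg_add[of g u] edeg_generator[of g] generators_subset by auto
  qed
  then show ?thesis
    by (auto simp: component_def edeg_zero)
qed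

lemma component_Suc: "component (Suc n) = {g + u | g u. g \<in> generators \<and> u \<in> component n}"
proof (intro equalityI subsetI)
  fix t assume t: "t \<in> component (Suc n)"
  then have "t \<noteq> 0" by (auto simp: component_def edeg_zero)
  moreover have "t \<in> exponents" using t by (simp add: component_def)
  ultimately obtain g u where g: "g \<in> generators" "u \<in> exponents" "t = g + u"
    using generator_divides by blast
  then have "edeg t = 1 + edeg u"
    using edeg_add[of g u] edeg_generator[of g] generators_subset by auto
  then have "u \<in> component n"
    using g t by (simp add: component_def)
  then show "t \<in> {g + u | g u. g \<in> generators \<and> u \<in> component n}"
    using g by blast
next
  fix t assume "t \<in> {g + u | g u. g \<in> generators \<and> u \<in> component n}"
  then obtain g u where "g \<in> generators" "u \<in> component n" "t = g + u" by blast
  moreover from this have "g \<in> exponents" "u \<in> exponents"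
    using generators_subset by (auto simp: component_def)
  ultimately show "t \<in> component (Suc n)"
    using edeg_add[of g u] edeg_generator[of g] by (simp add: component_def)
qed

lemma products_generators:
  "products (mon ` generators) n = (mon ` component n :: ('p, 'k::field) mpoly_xy poly set)"
proof (induction n)
  case 0
  show ?case by (simp add: products_0 component_0)
next
  case (Suc n)
  have "products (mon ` generators :: ('p, 'k) mpoly_xy poly set) (Suc n) =
      {mon g * mon u | g u. g \<in> generators \<and> u \<in> component n}"
    unfolding products_Suc Suc by blast
  also have "\<dots> = mon ` component (Suc n)"
    unfolding component_Suc mon_mult by blast
  finally show ?case .
qed

lemma rees_component_eq: "rees_component P r n = supported (component n)"
  unfolding rees_component_def rees_generators_eq products_generators by (rule span_mon)

text \<open>One inclusion holds because \<open>exponents\<close> is a semigroup containing the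
  generators; for the other, induction on the degree writes every monomial as a product of
  generators.\<close>

lemma rees_algebra_eq:
  "(rees_algebra P r :: ('p, 'k::field) mpoly_xy poly set) = supported exponents"
proof (intro equalityI subsetI)
  fix f :: "('p, 'k) mpoly_xy poly"
  assume "f \<in> rees_algebra P r"
  then show "f \<in> supported exponents"
    unfolding rees_algebra_def rees_generators_eq
  proof (induction rule: subalgebra_generated.induct)
    case one
    have "mon 0 \<in> (supported exponents :: ('p, 'k) mpoly_xy poly set)"
      by (subst mon_in_supported) simp
    then show ?case by simp
  next
    case (generator g)
    then show ?case using generators_subset by auto
  next
    case (mult f g)
    show ?case by (rule supported_mult[OF mult.IH add_in_exponents])
  qed (auto intro: supported_scale supported_add)
next
  let ?R = "rees_algebra P r :: ('p, 'k) mpoly_xy poly set"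
  have "1 \<in> ?R" and scale: "f \<in> ?R \<Longrightarrow> scale_K c f \<in> ?R"
    and add: "f \<in> ?R \<Longrightarrow> g \<in> ?R \<Longrightarrow> f + g \<in> ?R" and mult: "f \<in> ?R \<Longrightarrow> g \<in> ?R \<Longrightarrow> f * g \<in> ?R"
    and gen: "t \<in> generators \<Longrightarrow> mon t \<in> ?R" for f g c t
    unfolding rees_algebra_def rees_generators_eq by (auto intro: subalgebra_generated.intros)
  have mon: "mon t \<in> ?R" if "t \<in> component n" for t n
    using that
  proof (induction n arbitrary: t)
    case 0
    then show ?case using \<open>1 \<in> ?R\<close> by (simp add: component_0)
  next
    case (Suc n)
    then obtain g u where "g \<in> generators" "u \<in> component n" "t = g + u"
      by (auto simp: component_Suc)
    then show ?case using gen[of g] Suc.IH[of u] mult by (simp add: mon_mult[symmetric])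
  qed
  have "0 \<in> ?R"
    using scale[OF \<open>1 \<in> ?R\<close>, of 0] by simp
  then have sum: "(\<Sum>i\<in>S. f i) \<in> ?R" if "\<And>i. i \<in> S \<Longrightarrow> f i \<in> ?R"
    for S and f :: "'p exponent \<Rightarrow> ('p, 'k) mpoly_xy poly"
    using that by (induction S rule: infinite_finite_induct) (auto intro: add)
  fix f :: "('p, 'k) mpoly_xy poly"
  assume "f \<in> supported exponents"
  then have "mon t \<in> ?R" if "t \<in> supp f" for t
    using that mon[of t "edeg t"] by (auto simp: supported_def component_def)
  then show "f \<in> ?R"
    by (subst expansion) (intro sum scale)
qed

lemma coef_component:
  assumes "f \<in> supported (component n)" and "edeg t \<noteq> n"
  shows "coef f t = 0"
  using assms by (intro coef_supported[of f "component n"]) (auto simp: component_def)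

lemma standard_graded_rees:
  "standard_graded_algebra (scale_K :: 'k::field \<Rightarrow> _)
     (rees_algebra P r) (rees_component P r)"
proof
  fix c :: 'k and f g :: "('p, 'k) mpoly_xy poly"
  show "scale_K c (f * g) = scale_K c f * g" by (rule scale_K_mult)
next
  fix f :: "('p, 'k) mpoly_xy poly"
  show "f \<in> rees_algebra P r \<longleftrightarrow> (\<exists>h. (\<forall>n. h n \<in> rees_component P r n) \<and>
      finite {n. h n \<noteq> 0} \<and> f = (\<Sum>n | h n \<noteq> 0. h n))"
  proof
    assume "f \<in> rees_algebra P r"
    then have f: "f \<in> supported exponents" by (simp add: rees_algebra_eq)
    define h where "h n = (\<Sum>t\<in>supp f \<inter> component n. scale_K (coef f t) (mon t))" for n
    have coef_h: "coef (h n) t = (if edeg t = n then coef f t else 0)" for n t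
    proof -
      have "coef (h n) t = (if t \<in> supp f \<inter> component n then coef f t else 0)"
        by (simp add: h_def coef_sum coef_mon if_distrib cong: if_cong)
      then show ?thesis
        using f by (auto simp: component_def supported_def supp_def)
    qed
    have "{n. h n \<noteq> 0} \<subseteq> edeg ` supp f"
    proof
      fix n assume "n \<in> {n. h n \<noteq> 0}"
      then obtain t where "coef (h n) t \<noteq> 0"
        using coef_eqI[of "h n" 0] by auto
      then show "n \<in> edeg ` supp f"
        by (auto simp: coef_h supp_def split: if_splits)
    qed
    then have fin: "finite {n. h n \<noteq> 0}"
      by (rule finite_subset) simp
    have "f = (\<Sum>n | h n \<noteq> 0. h n)"
    proof (rule coef_eqI)
      fix t
      have "coef f t = 0" if "h (edeg t) = 0"
        using coef_h[of "edeg t" t] that by simp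
      then show "coef f t = coef (\<Sum>n | h n \<noteq> 0. h n) t"
        using fin by (auto simp: coef_sum coef_h)
    qed
    moreover have "h n \<in> rees_component P r n" for n
      unfolding rees_component_eq h_def by (auto intro!: supported_sum supported_scale)
    ultimately show "\<exists>h. (\<forall>n. h n \<in> rees_component P r n) \<and>
        finite {n. h n \<noteq> 0} \<and> f = (\<Sum>n | h n \<noteq> 0. h n)"
      using fin by blast
  next
    assume "\<exists>h. (\<forall>n. h n \<in> rees_component P r n) \<and>
      finite {n. h n \<noteq> 0} \<and> f = (\<Sum>n | h n \<noteq> 0. h n)"
    then obtain h where h: "\<And>n. h n \<in> supported (component n)" "f = (\<Sum>n | h n \<noteq> 0. h n)"
      by (auto simp: rees_component_eq)
    have "h n \<in> supported exponents" for n
      using h(1)[of n] by (auto simp: supported_def component_def)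
    then show "f \<in> rees_algebra P r"
      unfolding rees_algebra_eq h(2) by (intro supported_sum)
  qed
next
  fix h :: "nat \<Rightarrow> ('p, 'k) mpoly_xy poly" and n
  assume h: "\<forall>n. h n \<in> rees_component P r n" "finite {n. h n \<noteq> 0}" "(\<Sum>n | h n \<noteq> 0. h n) = 0"
  have *: "coef (h m) t = (if m = edeg t then coef (h m) t else 0)" for m t
    using h(1) coef_component[of "h m" m t] by (auto simp: rees_component_eq)
  have "coef (h n) t = 0" for t
  proof (cases "edeg t = n \<and> h n \<noteq> 0")
    case True
    have "coef (\<Sum>n | h n \<noteq> 0. h n) t = (\<Sum>m | h m \<noteq> 0. if m = edeg t then coef (h m) t else 0)"
      unfolding coef_sum by (rule sum.cong[OF refl *])
    also have "\<dots> = coef (h n) t"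
      using True h(2) by simp
    finally show ?thesis using h(3) by simp
  next
    case False
    then show ?thesis using *[of n t] by auto
  qed
  then show "h n = 0" by (intro coef_eqI) simp
next
  fix n
  show "rees_component P r n =
    scale_K.span (products (rees_component P r 1 :: ('p, 'k) mpoly_xy poly set) n)"
  proof (intro equalityI)
    have "mon ` generators \<subseteq> (rees_component P r 1 :: ('p, 'k) mpoly_xy poly set)"
      unfolding rees_component_eq using edeg_generator generators_subset
      by (auto simp: component_def)
    then show "rees_component P r n \<subseteq>
        scale_K.span (products (rees_component P r 1 :: ('p, 'k) mpoly_xy poly set) n)"
      unfolding rees_component_def[of P r n] rees_generators_eq
      by (intro scale_K.span_mono products_mono)
    have prod: "products (supported (component 1)) n \<subseteq> (supported (component n) :: ('p, 'k) mpoly_xy poly set)"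
    proof (induction n)
      case 0
      have "mon 0 \<in> (supported (component 0) :: ('p, 'k) mpoly_xy poly set)"
        by (subst mon_in_supported) (simp add: component_0)
      then show ?case by (simp add: products_0)
    next
      case (Suc n)
      have "s + t \<in> component (Suc n)" if "s \<in> component 1" "t \<in> component n" for s t
        using that edeg_add by (simp add: component_def)
      then have "f * g \<in> (supported (component (Suc n)) :: ('p, 'k) mpoly_xy poly set)"
        if "f \<in> supported (component 1)" "g \<in> supported (component n)" for f g
        by (rule supported_mult[OF that])
      then show ?case
        unfolding products_Suc using Suc by blast
    qed
    show "scale_K.span (products (rees_component P r 1) n) \<subseteq>
        (rees_component P r n :: ('p, 'k) mpoly_xy poly set)"
      using prod unfolding rees_component_eq span_mon[of "component n", symmetric]
      by (rule scale_K.span_minimal) (rule scale_K.subspace_span)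
  qed
next
  show "\<exists>B. finite B \<and>
    (rees_component P r 1 :: ('p, 'k) mpoly_xy poly set) = scale_K.span B"
    unfolding rees_component_def rees_generators_eq products_1
    using finite_generators by blast
qed

end

section \<open>The Koszul filtration\<close>

context finite_poset
begin

text \<open>An ideal generated by monomials is spanned by the monomials it contains. This turns the
  colon computations for exponents into colon ideals of \<open>R\<close>.\<close>

lemma ideal_mon:
  assumes ts: "set ts \<subseteq> exponents"
  shows "standard_graded_algebra.ideal (rees_algebra P r :: ('p, 'k::field) mpoly_xy poly set)
    (map mon ts) = supported (monomial_ideal (set ts))"
proof -
  interpret standard_graded_algebra "scale_K :: 'k \<Rightarrow> _"
    "rees_algebra P r :: ('p, 'k) mpoly_xy poly set" "rees_component P r"
    by (rule standard_graded_rees)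
  show ?thesis
  proof (intro equalityI subsetI)
    fix f :: "('p, 'k) mpoly_xy poly"
    assume "f \<in> ideal (map mon ts)"
    then obtain v where v: "v \<in> free_module (length ts)"
      and f: "f = (\<Sum>j<length ts. v j * map mon ts ! j)"
      by (auto simp: ideal_def)
    have "v j * map mon ts ! j \<in> supported (monomial_ideal (set ts))" if "j < length ts" for j
    proof (rule supported_mult)
      have "v j \<in> rees_algebra P r"
        using v that by (simp add: free_module_def)
      then show "v j \<in> supported exponents"
        by (simp add: rees_algebra_eq)
      show "map mon ts ! j \<in> supported {ts ! j}"
        using that by simp
      show "s + t \<in> monomial_ideal (set ts)" if "s \<in> exponents" "t \<in> {ts ! j}" for s t
        using that \<open>j < length ts\<close> unfolding monomial_ideal_def multiples_def
        by (intro UN_I[of "ts ! j"] image_eqI[of _ _ s]) (auto simp: add.commute)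
    qed
    then show "f \<in> supported (monomial_ideal (set ts))"
      unfolding f by (intro supported_sum) auto
  next
    fix f :: "('p, 'k) mpoly_xy poly"
    assume f: "f \<in> supported (monomial_ideal (set ts))"
    have zero: "0 \<in> ideal (map mon ts)"
      by (rule idealI[OF zero_in_free_module]) simp
    have "scale_K c (mon t) \<in> ideal (map mon ts)" if t: "t \<in> monomial_ideal (set ts)" for c t
    proof -
      obtain g u where g: "g \<in> set ts" "u \<in> exponents" "t = g + u"
        using t by (auto simp: monomial_ideal_def multiples_def)
      have "scale_K c (mon t) = scale_K c (mon u) * mon g"
        by (simp add: g(3) add.commute[of g] mon_mult[symmetric] scale_K_mult)
      also have "\<dots> \<in> ideal (map mon ts)"
        using g by (intro ideal_mult ideal_base) (auto simp: rees_algebra_eq supported_scale)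
      finally show ?thesis .
    qed
    then have "scale_K (coef f t) (mon t) \<in> ideal (map mon ts)" if "t \<in> supp f" for t
      using f that unfolding supported_def by blast
    then have "(\<Sum>t\<in>S. scale_K (coef f t) (mon t)) \<in> ideal (map mon ts)" if "S \<subseteq> supp f" for S
      using that by (induction S rule: infinite_finite_induct) (auto intro: zero ideal_add)
    from this[OF subset_refl] show "f \<in> ideal (map mon ts)"
      by (subst expansion)
  qed
qed

text \<open>The larger ideals \<open>I\<close> come first, so that the initial segments of \<open>us\<close> are up-closed, too.\<close>

definition filtration_lists :: "'p exponent list set" where
  "filtration_lists = {map gu us @ map gx xs @ map gy ys | us xs ys.
     distinct us \<and> distinct xs \<and> distinct ys \<and> set xs \<subseteq> P \<and> set ys \<subseteq> P \<and>
     up_closed (set us) \<and> sorted_wrt (\<lambda>I J. card J \<le> card I) us \<and>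
     (\<forall>p\<in>set xs. {J \<in> L. p \<in> J} \<subseteq> set us) \<and> (ys = [] \<or> set us = L)}"

lemma filtration_lists_exists:
  assumes "up_closed Q" and "A \<subseteq> P" and "B \<subseteq> P"
    and "\<And>p. p \<in> A \<Longrightarrow> {J \<in> L. p \<in> J} \<subseteq> Q" and "B = {} \<or> Q = L"
  shows "\<exists>ts\<in>filtration_lists. set ts = gu ` Q \<union> gx ` A \<union> gy ` B"
proof -
  have fin: "finite Q" "finite A" "finite B"
    using assms finite_P finite_L by (auto simp: up_closed_def intro: finite_subset)
  obtain us where us: "set us = Q" "distinct us"
    using finite_distinct_list[OF fin(1)] by blast
  obtain xs where xs: "set xs = A" "distinct xs"
    using finite_distinct_list[OF fin(2)] by blast
  obtain ys where ys: "set ys = B" "distinct ys"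
    using finite_distinct_list[OF fin(3)] by blast
  define us' where "us' = rev (sort_key card us)"
  have "sorted_wrt (\<lambda>I J. card J \<le> card I) us'"
    using sorted_sort_key[of card us] unfolding us'_def sorted_wrt_rev by (simp add: sorted_map)
  moreover have "set us' = Q" "distinct us'"
    using us by (simp_all add: us'_def)
  moreover have "ys = [] \<or> Q = L"
    using assms(5) ys by auto
  ultimately have "map gu us' @ map gx xs @ map gy ys \<in> filtration_lists"
    unfolding filtration_lists_def using assms xs ys
    by (intro CollectI exI[of _ us'] exI[of _ xs] exI[of _ ys]) auto
  moreover have "set (map gu us' @ map gx xs @ map gy ys) = gu ` Q \<union> gx ` A \<union> gy ` B"
    using \<open>set us' = Q\<close> xs ys by auto
  ultimately show ?thesis by blast
qed

lemma filtration_lists_generators: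
  assumes "ts \<in> filtration_lists"
  shows "set ts \<subseteq> generators"
proof -
  obtain us xs ys where ts: "ts = map gu us @ map gx xs @ map gy ys"
    and sub: "set xs \<subseteq> P" "set ys \<subseteq> P" and "up_closed (set us)"
    using assms unfolding filtration_lists_def by blast
  then have us: "set us \<subseteq> L" by (simp add: up_closed_def)
  have "set ts = gx ` set xs \<union> gy ` set ys \<union> gu ` set us"
    by (auto simp: ts)
  then show ?thesis
    unfolding generators_def using sub us by (simp only:) (intro Un_mono image_mono)
qed

lemma filtration_lists_colon:
  assumes "ts \<in> filtration_lists" and l: "l < length ts"
  shows "\<exists>ts'\<in>filtration_lists. \<forall>t\<in>exponents.
    t + ts ! l \<in> monomial_ideal (set (take l ts)) \<longleftrightarrow> t \<in> monomial_ideal (set ts')"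
proof -
  obtain us xs ys where ts: "ts = map gu us @ map gx xs @ map gy ys"
    and dist: "distinct us" "distinct xs" "distinct ys"
    and sub: "set xs \<subseteq> P" "set ys \<subseteq> P"
    and up: "up_closed (set us)"
    and sorted: "sorted_wrt (\<lambda>I J. card J \<le> card I) us"
    and xs: "\<And>p. p \<in> set xs \<Longrightarrow> {J \<in> L. p \<in> J} \<subseteq> set us"
    and ys: "ys = [] \<or> set us = L"
    using assms(1) unfolding filtration_lists_def by blast
  consider (u) "l < length us"
    | (x) i where "i < length xs" "l = length us + i"
    | (y) i where "i < length ys" "l = length us + length xs + i"
  proof -
    have "l < length us + length xs + length ys"
      using l by (simp add: ts)
    then have "l < length us \<or> (l - length us < length xs \<and> l = length us + (l - length us)) \<or>
        (l - length us - length xs < length ys \<and>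
          l = length us + length xs + (l - length us - length xs))"
      by linarith
    then show ?thesis using that by blast
  qed
  then show ?thesis
  proof cases
    case u
    define I where "I = us ! l"
    define Q where "Q = set (take l us)"
    have I: "I \<in> L" "I \<in> set us"
      using u up by (auto simp: I_def up_closed_def)
    have "us = take l us @ I # drop (Suc l) us"
      using u by (simp add: I_def id_take_nth_drop)
    then have "distinct (take l us @ I # drop (Suc l) us)"
      using dist(1) by simp
    then have notin: "I \<notin> Q"
      by (simp add: Q_def)
    \<comment> \<open>A strictly larger ideal has more elements, so the sorting puts it before
      \<open>us ! k\<close>. This is used at \<open>k = l\<close> for the ideals above
      \<open>I\<close>, and at smaller \<open>k\<close> for the up-closure of
      \<open>Q\<close>.\<close>
    have before: "J \<in> set (take k us)" if J: "J \<in> L" "us ! k \<subset> J" and k: "k < length us" for J k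
    proof -
      have "us ! k \<in> set us" using k by simp
      then have "J \<in> set us"
        using up J unfolding up_closed_def by blast
      then obtain j where j: "j < length us" "us ! j = J"
        by (auto simp: in_set_conv_nth)
      have "card (us ! k) < card J"
        using J(2) finite_subset[OF ideal_subset[OF J(1)] finite_P] by (rule psubset_card_mono[rotated])
      then have "\<not> k < j" and "k \<noteq> j"
        using sorted_wrt_nth_less[OF sorted, of k j] j J by auto
      then show ?thesis
        using j by (auto simp: in_set_conv_nth intro!: exI[of _ j])
    qed
    have "up_closed Q"
      unfolding up_closed_def
    proof (intro conjI ballI impI)
      show "Q \<subseteq> L"
        using up set_take_subset[of l us] by (auto simp: up_closed_def Q_def)
      fix I' J assume "I' \<in> Q" "J \<in> L" "I' \<subseteq> J"
      then obtain j where j: "j < l" "I' = us ! j"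
        using u by (auto simp: Q_def in_set_conv_nth)
      show "J \<in> Q"
      proof (cases "I' = J")
        case True
        then show ?thesis using \<open>I' \<in> Q\<close> by simp
      next
        case False
        then have "J \<in> set (take j us)"
          using before[of J j] \<open>J \<in> L\<close> \<open>I' \<subseteq> J\<close> j u by auto
        then show ?thesis
          using set_take_subset_set_take[of j l us] j by (auto simp: Q_def)
      qed
    qed
    moreover have "J \<in> Q" if "J \<in> L" "I \<subset> J" for J
      using before[OF that(1), of l] that u by (simp add: I_def Q_def)
    moreover have "\<exists>ts'\<in>filtration_lists.
        set ts' = gu ` {J \<in> L. \<not> J \<subseteq> I} \<union> gx ` min_outside I \<union> gy ` {}"
      by (rule filtration_lists_exists[OF up_closed_not_subset]) (auto simp: min_outside_def)
    then obtain ts' where "ts' \<in> filtration_lists"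
      "set ts' = gu ` {J \<in> L. \<not> J \<subseteq> I} \<union> gx ` min_outside I \<union> gy ` {}" ..
    ultimately show ?thesis
      using colon_gu[of Q I] I notin u
      by (intro bexI[of _ ts']) (auto simp: ts nth_append Q_def I_def take_map)
  next
    case x
    define p where "p = xs ! i"
    define A where "A = set (take i xs)"
    have p: "p \<in> P" "p \<in> set xs"
      using x sub by (auto simp: p_def)
    have "xs = take i xs @ p # drop (Suc i) xs"
      using x by (simp add: p_def id_take_nth_drop)
    then have "distinct (take i xs @ p # drop (Suc i) xs)"
      using dist(2) by simp
    then have notin: "p \<notin> A"
      by (simp add: A_def)
    have A: "A \<subseteq> set xs"
      by (simp add: A_def set_take_subset)
    have "A \<subseteq> P" using A sub by blast
    have "{J \<in> L. q \<in> J} \<subseteq> adjoin_below p (set us)" if "q \<in> A" for q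
      using xs[of q] A that unfolding adjoin_below_def by blast
    then have "\<exists>ts'\<in>filtration_lists.
        set ts' = gu ` adjoin_below p (set us) \<union> gx ` A \<union> gy ` {}"
      by (intro filtration_lists_exists[OF up_closed_adjoin_below[OF up] \<open>A \<subseteq> P\<close>]) auto
    then obtain ts' where "ts' \<in> filtration_lists"
      "set ts' = gu ` adjoin_below p (set us) \<union> gx ` A \<union> gy ` {}" ..
    then show ?thesis
      using colon_gx[OF up xs[OF p(2)] p(1) notin] A sub x
      by (intro bexI[of _ ts']) (auto simp: ts nth_append A_def p_def take_map)
  next
    case y
    define q where "q = ys ! i"
    define B where "B = set (take i ys)"
    have q: "q \<in> P" "q \<in> set ys"
      using y sub by (auto simp: q_def)
    have "ys = take i ys @ q # drop (Suc i) ys"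
      using y by (simp add: q_def id_take_nth_drop)
    then have "distinct (take i ys @ q # drop (Suc i) ys)"
      using dist(3) by simp
    then have notin: "q \<notin> B"
      by (simp add: B_def)
    have B: "B \<subseteq> set ys"
      by (simp add: B_def set_take_subset)
    have us: "set us = L"
      using ys q by auto
    have "B \<subseteq> P" using B sub by blast
    have "\<exists>ts'\<in>filtration_lists. set ts' = gu ` L \<union> gx ` set xs \<union> gy ` B"
      by (rule filtration_lists_exists[OF up[unfolded us] sub(1) \<open>B \<subseteq> P\<close> xs[unfolded us]]) auto
    then obtain ts' where "ts' \<in> filtration_lists"
      "set ts' = gu ` L \<union> gx ` set xs \<union> gy ` B" ..
    then show ?thesis
      using colon_gy[OF q(1) notin _ sub(1)] B sub y us
      by (intro bexI[of _ ts']) (auto simp: ts nth_append B_def q_def take_map Un_assoc)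
  qed
qed

theorem koszul_rees:
  "koszul_algebra (scale_K :: 'k::field \<Rightarrow> _) (rees_algebra P r) (rees_component P r)"
proof -
  interpret standard_graded_algebra "scale_K :: 'k \<Rightarrow> _"
    "rees_algebra P r :: ('p, 'k) mpoly_xy poly set" "rees_component P r"
    by (rule standard_graded_rees)
  define F where "F = (map mon ` filtration_lists :: ('p, 'k) mpoly_xy poly list set)"
  have exps: "set ts \<subseteq> exponents" if "ts \<in> filtration_lists" for ts
    using filtration_lists_generators[OF that] generators_subset by blast
  have "koszul_filtration F"
    unfolding koszul_filtration_def
  proof (intro ballI conjI allI impI)
    fix gs assume "gs \<in> F"
    then obtain ts where ts: "ts \<in> filtration_lists" "gs = map mon ts"
      by (auto simp: F_def)
    have "set ts \<subseteq> component 1"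
      using filtration_lists_generators[OF ts(1)] edeg_generator generators_subset
      unfolding component_def by blast
    then show "set gs \<subseteq> rees_component P r 1"
      unfolding ts(2) rees_component_eq by auto
    fix l assume "l < length gs"
    then have l: "l < length ts" by (simp add: ts(2))
    obtain ts' where ts': "ts' \<in> filtration_lists" "\<And>t. t \<in> exponents \<Longrightarrow>
        t + ts ! l \<in> monomial_ideal (set (take l ts)) \<longleftrightarrow> t \<in> monomial_ideal (set ts')"
      using filtration_lists_colon[OF ts(1) l] by blast
    have "set (take l ts) \<subseteq> exponents"
      using exps[OF ts(1)] set_take_subset[of l ts] by blast
    then have "ideal (take l gs) = supported (monomial_ideal (set (take l ts)))"
      by (simp add: ts(2) take_map ideal_mon)
    moreover have "ideal (map mon ts') = supported (monomial_ideal (set ts'))"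
      by (rule ideal_mon[OF exps[OF ts'(1)]])
    \<comment> \<open>Multiplication by a monomial only shifts the support, so the colon can be
      tested term by term.\<close>
    moreover have "f * gs ! l \<in> supported (monomial_ideal (set (take l ts))) \<longleftrightarrow>
        f \<in> supported (monomial_ideal (set ts'))" if "f \<in> rees_algebra P r" for f
    proof -
      have "f * gs ! l \<in> supported (monomial_ideal (set (take l ts))) \<longleftrightarrow>
          (\<forall>t\<in>supp f. t + ts ! l \<in> monomial_ideal (set (take l ts)))"
        using l by (simp add: ts(2) supported_def supp_mult_mon image_subset_iff)
      also have "\<dots> \<longleftrightarrow> (\<forall>t\<in>supp f. t \<in> monomial_ideal (set ts'))"
      proof (rule ball_cong[OF refl])
        fix t assume "t \<in> supp f"
        then have "t \<in> exponents"
          using that unfolding rees_algebra_eq supported_def by blast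
        then show "t + ts ! l \<in> monomial_ideal (set (take l ts)) \<longleftrightarrow>
            t \<in> monomial_ideal (set ts')" by (rule ts'(2))
      qed
      also have "\<dots> \<longleftrightarrow> f \<in> supported (monomial_ideal (set ts'))"
        by (simp add: supported_def subset_eq)
      finally show ?thesis .
    qed
    ultimately have "f * gs ! l \<in> ideal (take l gs) \<longleftrightarrow> f \<in> ideal (map mon ts')"
      if "f \<in> rees_algebra P r" for f
      using that by simp
    then show "\<exists>gs'\<in>F. \<forall>f\<in>rees_algebra P r. f * gs ! l \<in> ideal (take l gs) \<longleftrightarrow> f \<in> ideal gs'"
      using ts'(1) by (auto simp: F_def)
  qed
  \<comment> \<open>The largest member of the family contains all generators, so it generates the
    irrelevant ideal and can start the resolution.\<close>
  moreover have "\<exists>ts\<in>filtration_lists. set ts = gu ` L \<union> gx ` P \<union> gy ` P"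
    by (rule filtration_lists_exists) (auto simp: up_closed_def)
  then obtain ts where ts: "ts \<in> filtration_lists" "set ts = gu ` L \<union> gx ` P \<union> gy ` P" ..
  then have gens: "set ts = generators"
    by (auto simp: generators_def)
  have "map mon ts \<in> F"
    using ts(1) by (simp add: F_def)
  moreover have "ideal (map mon ts) = irrelevant_ideal"
  proof -
    let ?C = "\<Union>n. rees_component P r (Suc n) :: ('p, 'k) mpoly_xy poly set"
    have "monomial_ideal generators = (\<Union>n. component (Suc n))"
    proof (intro equalityI subsetI)
      fix t assume "t \<in> monomial_ideal generators"
      then obtain g u where g: "g \<in> generators" "u \<in> exponents" "t = g + u"
        by (auto simp: monomial_ideal_def multiples_def)
      then have "u \<in> component (edeg u)" by (simp add: component_def)
      then show "t \<in> (\<Union>n. component (Suc n))"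
        using g unfolding component_Suc by blast
    next
      fix t assume "t \<in> (\<Union>n. component (Suc n))"
      then obtain g u n where "g \<in> generators" "u \<in> component n" "t = g + u"
        unfolding component_Suc by blast
      then show "t \<in> monomial_ideal generators"
        unfolding monomial_ideal_def multiples_def component_def by blast
    qed
    then have "ideal (map mon ts) = supported (\<Union>n. component (Suc n))"
      using ideal_mon[OF exps[OF ts(1)]] by (simp add: gens)
    also have "\<dots> = scale_K.span ?C"
    proof (intro equalityI)
      have "mon ` (\<Union>n. component (Suc n)) \<subseteq>
          ?C"
        by (auto simp: rees_component_eq)
      then show "supported (\<Union>n. component (Suc n)) \<subseteq> scale_K.span ?C"
        unfolding span_mon[symmetric] by (rule scale_K.span_mono)
      show "scale_K.span ?C \<subseteq> supported (\<Union>n. component (Suc n))"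
      proof (rule scale_K.span_minimal)
        show "?C \<subseteq> supported (\<Union>n. component (Suc n))"
          unfolding rees_component_eq by (intro UN_least supported_mono) blast
        show "scale_K.subspace (supported (\<Union>n. component (Suc n)))"
          unfolding span_mon[symmetric] by (rule scale_K.subspace_span)
      qed
    qed
    finally show ?thesis by (simp add: irrelevant_ideal_def)
  qed
  ultimately show ?thesis
    by unfold_locales (rule linear_resolution_of_koszul_filtration)
qed

end

section \<open>Normality\<close>

lemma Fract_power: "(Fract a b) ^ i = Fract (a ^ i) (b ^ i :: 'a::idom)"
  by (induction i) (simp_all add: One_fract_def)

text \<open>The denominator is \<open>g ^ n\<close>, with \<open>n\<close> the degree of the monic
  equation: it clears the powers of \<open>f / g\<close> below \<open>n\<close>, and the equation
  rewrites each higher power through lower ones.\<close>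

lemma almost_integral_if_integral:
  fixes R :: "'a::idom set"
  assumes R: "1 \<in> R" "\<And>x y. x \<in> R \<Longrightarrow> y \<in> R \<Longrightarrow> x - y \<in> R" "\<And>x y. x \<in> R \<Longrightarrow> y \<in> R \<Longrightarrow> x * y \<in> R"
    and "f \<in> R" "g \<in> R" "g \<noteq> 0"
    and "integral_over ((\<lambda>a. Fract a 1) ` R) (Fract f g)"
  shows "\<exists>d\<in>R. d \<noteq> 0 \<and> (\<forall>i. \<exists>e\<in>R. d * f ^ i = e * g ^ i)"
proof -
  define R' where "R' = (\<lambda>a. Fract a 1) ` R"
  define z where "z = Fract f g"
  have zero: "0 \<in> R" using R(2)[OF R(1) R(1)] by simp
  have R'_diff: "x - y \<in> R'" and R'_mult: "x * y \<in> R'" if "x \<in> R'" "y \<in> R'" for x y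
  proof -
    obtain a b where ab: "a \<in> R" "b \<in> R" "x = Fract a 1" "y = Fract b 1"
      using \<open>x \<in> R'\<close> \<open>y \<in> R'\<close> by (auto simp: R'_def)
    have "x - y = Fract (a - b) 1" "x * y = Fract (a * b) 1"
      by (simp_all add: ab)
    then show "x - y \<in> R'" "x * y \<in> R'"
      using R ab by (auto simp: R'_def)
  qed
  have R'_zero: "0 \<in> R'"
    using zero by (auto simp: R'_def Zero_fract_def)
  have R'_uminus: "- x \<in> R'" if "x \<in> R'" for x
    using R'_diff[OF R'_zero that] by simp
  have R'_add: "x + y \<in> R'" if "x \<in> R'" "y \<in> R'" for x y
    using R'_diff[OF that(1) R'_uminus[OF that(2)]] by simp
  have R'_sum: "(\<Sum>j\<in>S. h j) \<in> R'" if "\<And>j. j \<in> S \<Longrightarrow> h j \<in> R'" for S :: "nat set" and h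
    using that by (induction S rule: infinite_finite_induct) (auto intro: R'_zero R'_add)
  have power: "a ^ n \<in> R" if "a \<in> R" for a n
    using that R by (induction n) auto
  obtain q where q: "lead_coeff q = 1" "\<And>i. coeff q i \<in> R'" "poly q z = 0"
    using assms(7) by (auto simp: integral_over_def R'_def z_def)
  define n where "n = degree q"
  have zn: "z ^ n = - (\<Sum>j<n. coeff q j * z ^ j)"
  proof -
    have "0 = (\<Sum>j<Suc n. coeff q j * z ^ j)"
      using q(3) by (simp add: poly_altdef n_def lessThan_Suc_atMost)
    also have "\<dots> = (\<Sum>j<n. coeff q j * z ^ j) + z ^ n"
      using q(1) by (simp add: n_def)
    finally show ?thesis by (simp add: eq_neg_iff_add_eq_0 add.commute)
  qed
  define D where "D = Fract (g ^ n) 1"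
  have "D * z ^ i \<in> R'" for i
  proof (induction i rule: less_induct)
    case (less i)
    show ?case
    proof (cases "i < n")
      case True
      have "g ^ n = g ^ (n - i) * g ^ i"
        using True by (simp add: power_add[symmetric])
      then have "D * z ^ i = Fract (g ^ (n - i) * f ^ i) 1"
        using \<open>g \<noteq> 0\<close> by (simp add: D_def z_def Fract_power eq_fract)
      then show ?thesis
        using R power assms(4,5) by (auto simp: R'_def)
    next
      case False
      then have "z ^ i = z ^ (i - n) * z ^ n"
        by (simp add: power_add[symmetric])
      also have "\<dots> = - (\<Sum>j<n. coeff q j * z ^ (i - n + j))"
        by (simp add: zn sum_distrib_left power_add mult.left_commute)
      finally have eq: "D * z ^ i = - (\<Sum>j<n. coeff q j * (D * z ^ (i - n + j)))"
        by (simp add: sum_distrib_left mult.left_commute)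
      have mem: "coeff q j * (D * z ^ (i - n + j)) \<in> R'" if "j \<in> {..<n}" for j
        by (intro R'_mult[OF q(2)] less) (use False that in auto)
      show ?thesis
        unfolding eq by (rule R'_uminus[OF R'_sum[OF mem]])
    qed
  qed
  moreover have "D * z ^ i = Fract (g ^ n * f ^ i) (g ^ i)" for i
    by (simp add: D_def z_def Fract_power)
  ultimately have "\<exists>e\<in>R. Fract (g ^ n * f ^ i) (g ^ i) = Fract e 1" for i
    by (auto simp: R'_def image_iff)
  then have "\<exists>e\<in>R. g ^ n * f ^ i = e * g ^ i" for i
    using \<open>g \<noteq> 0\<close> by (simp add: eq_fract)
  then show ?thesis
    using power[OF \<open>g \<in> R\<close>, of n] \<open>g \<noteq> 0\<close> by (intro bexI[of _ "g ^ n"]) auto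
qed

section \<open>Leading monomials and division in the Rees algebra\<close>

context finite_poset
begin

text \<open>Since keys compare \<open>edeg\<close> first, only finitely many exponents lie below a
  given key; their number is the measure for the division by \<open>g\<close>.\<close>

lemma finite_component: "finite (component n)"
proof (induction n)
  case 0
  then show ?case by (simp add: component_0)
next
  case (Suc n)
  have "component (Suc n) = (\<Union>g\<in>generators. (+) g ` component n)"
    unfolding component_Suc by blast
  then show ?case using Suc finite_generators by simp
qed

text \<open>
  The order of the keys is compatible with addition only on \<open>exponents\<close>, where \<open>edeg\<close> is additive.
\<close>

definition key :: "'p exponent \<Rightarrow> nat \<times> 'p exponent" where
  "key t = (edeg t, t)"

lemma key_less_iff: "key s < key t \<longleftrightarrow> edeg s < edeg t \<or>
    edeg s = edeg t \<and> (fst s < fst t \<or> fst s = fst t \<and> snd s < snd t)"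
  by (auto simp: key_def less_prod_def le_less)

lemma key_add_mono:
  assumes "s \<in> exponents" "t \<in> exponents" "u \<in> exponents" and "key s < key t"
  shows "key (s + u) < key (t + u)"
  using assms by (auto simp: key_less_iff edeg_add)

definition lead :: "('p, 'k::field) mpoly_xy poly \<Rightarrow> 'p exponent" where
  "lead f = snd (Max (key ` supp f))"

lemma supp_nonempty: "f \<noteq> 0 \<Longrightarrow> supp f \<noteq> {}"
  using coef_eqI[of f 0] by (auto simp: supp_def)

lemma
  assumes "f \<noteq> 0"
  shows lead_in_supp: "lead f \<in> supp f"
    and key_le_lead: "t \<in> supp f \<Longrightarrow> key t \<le> key (lead f)"
proof -
  have "Max (key ` supp f) \<in> key ` supp f"
    using supp_nonempty[OF assms] by (intro Max_in) auto
  then have "Max (key ` supp f) = key (lead f) \<and> lead f \<in> supp f"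
    by (auto simp: lead_def key_def)
  then show "lead f \<in> supp f" and "t \<in> supp f \<Longrightarrow> key t \<le> key (lead f)"
    using Max_ge[of "key ` supp f" "key t"] by auto
qed

lemma lead_in_exponents: "f \<in> supported exponents \<Longrightarrow> f \<noteq> 0 \<Longrightarrow> lead f \<in> exponents"
  using lead_in_supp by (auto simp: supported_def)

lemma lead_eqI:
  assumes "t \<in> supp f" and "\<And>s. s \<in> supp f \<Longrightarrow> key s \<le> key t"
  shows "lead f = t"
proof -
  have "Max (key ` supp f) = key t"
    using assms by (intro Max_eqI) auto
  then show ?thesis by (simp add: lead_def key_def)
qed

lemma key_add_le:
  assumes "s \<in> exponents" "t \<in> exponents" "s' \<in> exponents" "t' \<in> exponents"
    and "key s \<le> key s'" "key t \<le> key t'"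
  shows "key (s + t) \<le> key (s' + t')" and "s + t = s' + t' \<Longrightarrow> s = s' \<and> t = t'"
proof -
  have 1: "key (s + t) < key (s' + t) \<or> s = s'"
    using key_add_mono[OF assms(1,3,2)] le_imp_less_or_eq[OF assms(5)] unfolding key_def by blast
  have 2: "key (s' + t) < key (s' + t') \<or> t = t'"
    using key_add_mono[OF assms(2,4,3)] le_imp_less_or_eq[OF assms(6)]
    unfolding key_def add.commute[of s'] by blast
  show "key (s + t) \<le> key (s' + t')"
    using 1 2 by auto
  show "s = s' \<and> t = t'" if "s + t = s' + t'"
    using 1 2 that by auto
qed

text \<open>No other pair of terms multiplies to the product of the leading terms, so its
  coefficient is a product of two nonzero scalars.\<close>

lemma lead_mult:
  assumes f: "f \<in> supported exponents" "f \<noteq> 0" and g: "g \<in> supported exponents" "g \<noteq> 0"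
  shows "lead (f * g) = lead f + lead g"
proof -
  have exps: "s \<in> exponents" "t \<in> exponents" if "s \<in> supp f" "t \<in> supp g" for s t
    using that f g by (auto simp: supported_def)
  note lead = lead_in_supp[OF f(2)] lead_in_supp[OF g(2)]
  have unique: "s + t = lead f + lead g \<longleftrightarrow> s = lead f \<and> t = lead g"
    if "s \<in> supp f" "t \<in> supp g" for s t
    using key_add_le(2)[of s t "lead f" "lead g"] exps that lead key_le_lead f g by blast
  show ?thesis
  proof (rule lead_eqI)
    have "coef (f * g) (lead f + lead g) = (\<Sum>s\<in>supp f. \<Sum>u\<in>supp g.
        if s = lead f then (if u = lead g then coef f s * coef g u else 0) else 0)"
      unfolding coef_mult by (intro sum.cong refl) (auto simp: unique)
    also have "\<dots> = (\<Sum>s\<in>supp f. if s = lead f then (\<Sum>u\<in>supp g.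
        if u = lead g then coef f s * coef g u else 0) else 0)"
      by (intro sum.cong refl) auto
    also have "\<dots> = coef f (lead f) * coef g (lead g)"
      using lead by (simp add: sum.delta)
    finally show "lead f + lead g \<in> supp (f * g)"
      using lead by (simp add: supp_def)
  next
    fix t assume "t \<in> supp (f * g)"
    then obtain s u where "s \<in> supp f" "u \<in> supp g" "t = s + u"
      by (rule supp_mult)
    then show "key t \<le> key (lead f + lead g)"
      using key_add_le(1)[of s u "lead f" "lead g"] exps lead key_le_lead f g by blast
  qed
qed

lemma one_in_supported: "1 \<in> supported exponents"
  using mon_in_supported[of 0 exponents] by (simp del: mon_in_supported)

lemma mult_in_supported:
  "f \<in> supported exponents \<Longrightarrow> g \<in> supported exponents \<Longrightarrow> f * g \<in> supported exponents"
  by (rule supported_mult[OF _ _ add_in_exponents])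

lemma power_in_supported: "f \<in> supported exponents \<Longrightarrow> f ^ n \<in> supported exponents"
  by (induction n) (auto intro: one_in_supported mult_in_supported)

lemma lead_one: "lead (1 :: ('p, 'k::field) mpoly_xy poly) = 0"
proof -
  have "supp (1 :: ('p, 'k) mpoly_xy poly) = {0}"
    using supp_mon[of 0] by simp
  then show "lead (1 :: ('p, 'k) mpoly_xy poly) = 0"
    by (intro lead_eqI) auto
qed

lemma functional_lead_power:
  fixes \<phi> :: "'p exponent \<Rightarrow> int"
  assumes add: "\<And>s t. \<phi> (s + t) = \<phi> s + \<phi> t" and f: "f \<in> supported exponents" "f \<noteq> 0"
  shows "\<phi> (lead (f ^ i)) = int i * \<phi> (lead f)"
proof (induction i)
  case 0
  have "\<phi> 0 = 0" using add[of 0 0] by simp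
  then show ?case by (simp add: lead_one)
next
  case (Suc i)
  then show ?case
    using f by (simp add: lead_mult power_in_supported add algebra_simps)
qed

text \<open>
  Every functional cutting out the cone of \<open>exponents\<close> is nonnegative on
  \<open>lead d + i (lead f - lead g)\<close> for all \<open>i\<close>, hence on \<open>lead f - lead g\<close>.
\<close>

lemma lead_multiple:
  assumes f: "f \<in> supported exponents" "f \<noteq> 0" and g: "g \<in> supported exponents" "g \<noteq> 0"
    and d: "d \<in> supported exponents" "d \<noteq> 0"
    and int: "\<And>i. \<exists>e\<in>supported exponents. d * f ^ i = e * g ^ i"
  shows "lead f \<in> multiples (lead g)"
proof -
  have le: "\<phi> (lead g) \<le> \<phi> (lead f)"
    if add: "\<And>s t. \<phi> (s + t) = \<phi> s + \<phi> t" and nonneg: "\<And>t. t \<in> exponents \<Longrightarrow> 0 \<le> \<phi> t"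
    for \<phi> :: "'p exponent \<Rightarrow> int"
  proof (rule ccontr)
    assume "\<not> \<phi> (lead g) \<le> \<phi> (lead f)"
    \<comment> \<open>As \<open>\<phi>\<close> takes integer values, the gap between
      \<open>\<phi> (lead g)\<close> and \<open>\<phi> (lead f)\<close> is at least 1, so
      \<open>i\<close> times the gap exceeds \<open>\<phi> (lead d)\<close>.\<close>
    define i where "i = nat (\<phi> (lead d)) + 1"
    obtain e where e: "e \<in> supported exponents" "d * f ^ i = e * g ^ i"
      using int by blast
    then have "e \<noteq> 0" using d f by auto
    have "\<phi> (lead (d * f ^ i)) = \<phi> (lead d) + int i * \<phi> (lead f)"
      using d f by (simp add: lead_mult power_in_supported add functional_lead_power[of \<phi>, OF add])
    moreover have "\<phi> (lead (e * g ^ i)) = \<phi> (lead e) + int i * \<phi> (lead g)"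
      using e(1) \<open>e \<noteq> 0\<close> g by (simp add: lead_mult power_in_supported add functional_lead_power[of \<phi>, OF add])
    moreover have "0 \<le> \<phi> (lead e)"
      by (rule nonneg[OF lead_in_exponents[OF e(1) \<open>e \<noteq> 0\<close>]])
    ultimately have "int i * (\<phi> (lead g) - \<phi> (lead f)) \<le> \<phi> (lead d)"
      using e(2) by (simp add: algebra_simps)
    moreover have "int i * 1 \<le> int i * (\<phi> (lead g) - \<phi> (lead f))"
      using \<open>\<not> \<phi> (lead g) \<le> \<phi> (lead f)\<close> by (intro mult_left_mono) auto
    moreover have "\<phi> (lead d) < int i"
      by (simp add: i_def)
    ultimately show False by linarith
  qed
  have "x_exp (lead g) p \<le> x_exp (lead f) p" "y_exp (lead g) p \<le> y_exp (lead f) p" for p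
    using le[of "\<lambda>t. int (x_exp t p)"] le[of "\<lambda>t. int (y_exp t p)"] by simp_all
  moreover have "snd (lead g) \<le> snd (lead f)"
    using le[of "\<lambda>t. int (snd t)"] by simp
  moreover have "snd (lead f) + x_exp (lead g) p + y_exp (lead g) q \<le>
      x_exp (lead f) p + y_exp (lead f) q + snd (lead g)" if "(p, q) \<in> r" for p q
  proof -
    have "int (x_exp (lead g) p) + int (y_exp (lead g) q) - int (snd (lead g)) \<le>
        int (x_exp (lead f) p) + int (y_exp (lead f) q) - int (snd (lead f))"
    proof (rule le[of "\<lambda>t. int (x_exp t p) + int (y_exp t q) - int (snd t)"])
      show "0 \<le> int (x_exp t p) + int (y_exp t q) - int (snd t)" if "t \<in> exponents" for t
        using exponents_le[OF that \<open>(p, q) \<in> r\<close>] by linarith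
    qed simp
    then show ?thesis by linarith
  qed
  ultimately show ?thesis
    using f g by (subst multiples_iff) (auto simp: lead_in_exponents)
qed

lemma almost_integral_quotient:
  assumes g: "g \<in> supported exponents" "g \<noteq> 0" and d: "d \<in> supported exponents" "d \<noteq> 0"
    and "f \<in> supported exponents"
    and "\<And>i. \<exists>e\<in>supported exponents. d * f ^ i = e * g ^ i"
  shows "\<exists>h\<in>supported exponents. f = h * g"
  using assms(5,6)
proof (induction "card {s \<in> exponents. key s < key (lead f)}" arbitrary: f rule: less_induct)
  case less
  note f = less.prems(1)
  show ?case
  proof (cases "f = 0")
    case True
    then show ?thesis by (intro bexI[of _ 0]) auto
  next
    case False
    obtain s where s: "s \<in> exponents" "lead f = lead g + s"
      using lead_multiple[OF f False g d less.prems(2)] by (auto simp: multiples_def)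
    define c where "c = coef f (lead f) / coef g (lead g)"
    define m where "m = scale_K c (mon s)"
    have m: "m \<in> supported exponents"
      using s by (simp add: m_def supported_scale)
    define f' where "f' = f - m * g"
    have f': "f' \<in> supported exponents"
      unfolding f'_def by (intro supported_diff f mult_in_supported m g)
    have powers: "\<exists>e\<in>supported exponents. d * f ^ j * f' ^ i = e * g ^ (i + j)" for i j
    proof (induction i arbitrary: j)
      case 0
      then show ?case using less.prems(2)[of j] by simp
    next
      case (Suc i)
      obtain e1 where e1: "e1 \<in> supported exponents" "d * f ^ Suc j * f' ^ i = e1 * g ^ (i + Suc j)"
        using Suc by blast
      obtain e2 where e2: "e2 \<in> supported exponents" "d * f ^ j * f' ^ i = e2 * g ^ (i + j)"
        using Suc by blast
      have "d * f ^ j * f' ^ Suc i = d * f ^ Suc j * f' ^ i - m * g * (d * f ^ j * f' ^ i)"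
        by (simp add: f'_def algebra_simps)
      also have "\<dots> = (e1 - m * e2) * g ^ (Suc i + j)"
        unfolding e1(2) e2(2) by (simp add: algebra_simps)
      finally show ?case
        using e1(1) e2(1) m by (intro bexI[of _ "e1 - m * e2"] supported_diff mult_in_supported)
    qed
    have "\<exists>h\<in>supported exponents. f' = h * g"
    proof (cases "f' = 0")
      case True
      then show ?thesis by (intro bexI[of _ 0]) auto
    next
      case f'0: False
      have mg: "m * g = scale_K c (g * mon s)"
        by (simp only: m_def scale_K_mult[symmetric] mult.commute[of "mon s"])
      have "coef (m * g) (lead f) = coef f (lead f)"
        using lead_in_supp[OF g(2)] by (simp add: mg s(2) coef_mult_mon c_def supp_def)
      then have "lead f \<notin> supp f'"
        by (simp add: f'_def supp_def)
      moreover have "key t \<le> key (lead f)" if "t \<in> supp f'" for t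
      proof -
        have "t \<in> supp f \<or> t \<in> supp (g * mon s)"
          using that by (auto simp: f'_def mg supp_def)
        then show ?thesis
        proof
          assume "t \<in> supp (g * mon s)"
          then obtain u where u: "u \<in> supp g" "t = u + s"
            by (auto simp: supp_mult_mon)
          then show ?thesis
            using key_add_le(1)[of u s "lead g" s] key_le_lead[OF g(2) u(1)] s
              lead_in_exponents[OF g] g by (auto simp: supported_def)
        qed (rule key_le_lead[OF False])
      qed
      ultimately have "key (lead f') < key (lead f)"
        using lead_in_supp[OF f'0] by (metis key_def le_less prod.inject)
      then have "{s \<in> exponents. key s < key (lead f')} \<subset> {s \<in> exponents. key s < key (lead f)}"
        using lead_in_exponents[OF f' f'0] by auto
      moreover have "finite {s \<in> exponents. key s < key (lead f)}"
      proof (rule finite_subset)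
        show "{s \<in> exponents. key s < key (lead f)} \<subseteq> (\<Union>n\<le>edeg (lead f). component n)"
          by (auto simp: key_def component_def less_prod_def)
      qed (use finite_component in simp)
      ultimately have "card {s \<in> exponents. key s < key (lead f')} <
          card {s \<in> exponents. key s < key (lead f)}"
        by (rule psubset_card_mono[rotated])
      then show ?thesis
        using f' powers[of 0] by (intro less.hyps) auto
    qed
    then obtain h where "h \<in> supported exponents" "f' = h * g" ..
    then have "f = (h + m) * g"
      by (simp add: f'_def algebra_simps)
    then show ?thesis
      using \<open>h \<in> supported exponents\<close> m by (intro bexI[of _ "h + m"] supported_add)
  qed
qed

theorem normal_rees:
  "normal_domain (rees_algebra P r :: ('p, 'k::field) mpoly_xy poly set)"
  unfolding normal_domain_def rees_algebra_eq
proof (intro conjI ballI impI)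
  let ?R = "supported exponents :: ('p, 'k) mpoly_xy poly set"
  show one: "1 \<in> ?R" by (rule one_in_supported)
  show "f - g \<in> ?R" "f * g \<in> ?R" if "f \<in> ?R" "g \<in> ?R" for f g
    using that by (auto intro: supported_diff mult_in_supported)
  fix z assume "z \<in> fractions ?R" and int: "integral_over ((\<lambda>a. Fract a 1) ` ?R) z"
  then obtain f g where fg: "f \<in> ?R" "g \<in> ?R" "g \<noteq> 0" "z = Fract f g"
    by (auto simp: fractions_def)
  obtain d where "d \<in> ?R" "d \<noteq> 0" "\<And>i. \<exists>e\<in>?R. d * f ^ i = e * g ^ i"
    using almost_integral_if_integral[of ?R f g] one supported_diff mult_in_supported fg int by blast
  then obtain h where "h \<in> ?R" "f = h * g"
    using almost_integral_quotient[of g d f] fg by blast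
  then have "z = Fract h 1"
    using fg by (simp add: eq_fract)
  then show "z \<in> (\<lambda>a. Fract a 1) ` ?R"
    using \<open>h \<in> ?R\<close> by blast
qed

end

theorem corollary1p2:
  fixes P :: "'p set" and r :: "'p rel"
  assumes "finite P" and "partial_order_on P r"
  shows "normal_domain (rees_algebra P r :: ('p, 'k::field) mpoly_xy poly set) \<and>
    koszul_algebra (scale_K :: 'k \<Rightarrow> ('p, 'k) mpoly_xy poly \<Rightarrow> ('p, 'k) mpoly_xy poly)
      (rees_algebra P r) (rees_component P r)"
proof -
  interpret finite_poset P r
    by (rule finite_poset.intro[OF assms])
  show ?thesis
    using normal_rees koszul_rees by blast
qed

end
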